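(* Let $P$ and $Q$ be finite $\pi$-calculus processes. If for every $\mathcal{OM}$ formula $\phi$ we have $P\vDash\phi$ if and only if $Q\vDash\phi$, then $P\sim Q$ (open bisimilarity).
   Context: Names range over a countably infinite set. Actions: $\pi ::= \tau \mid \overline{x}z \mid \overline{x}(z) \mid x(z)$. Finite processes: $P ::= 0 \mid \nu x.P \mid \pi.P \mid [x=y]P \mid P \| P \mid P + P$. The binders $\nu x.P$, $z(x).P$, $\overline{z}(x).P$ bind $x$ in $P$; processes are up to $\alpha$-conversion; $\mathrm{fv}(E)$ denotes free names. Set $\mathrm{n}(x(y))=\mathrm{n}(\overline{x}(y))=\mathrm{n}(\overline{x}y)=\{x,y\}$, $\mathrm{bn}(x(y))=\mathrm{bn}(\overline{x}(y))=\{y\}$, $\mathrm{n}(\tau)=\mathrm{bn}(\tau)=\mathrm{bn}(\overline{x}y)=\emptyset$. The late labelled transition relation $P\xrightarrow{\pi}Q$ is the least relation closed under: $\pi.P \xrightarrow{\pi} P$; if $P\xrightarrow{\overline{x}z}Q$ and $x\neq z$ then $\nu z.P \xrightarrow{\overline{x}(z)} Q$; if $P\xrightarrow{\pi}R$ then $P+Q\xrightarrow{\pi}R$ and $Q+P\xrightarrow{\pi}R$; if $P\xrightarrow{\pi}R$ then $[x=x]P\xrightarrow{\pi}R$; if $P\xrightarrow{\pi}Q$ and $x\notin\mathrm{n}(\pi)$ then $\nu x.P\xrightarrow{\pi}\nu x.Q$; if $P\xrightarrow{\pi}Q$ and the names in $\mathrm{bn}(\pi)$ are fresh for $R$ then $P\|R\xrightarrow{\pi}Q\|R$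 and $R\|P\xrightarrow{\pi}R\|Q$; if $P\xrightarrow{\overline{x}(z)}P'$ and $Q\xrightarrow{x(z)}Q'$ then $P\|Q\xrightarrow{\tau}\nu z.(P'\|Q')$ and $Q\|P\xrightarrow{\tau}\nu z.(Q'\|P')$; if $P\xrightarrow{\overline{x}y}P'$ and $Q\xrightarrow{x(z)}Q'$ then $P\|Q\xrightarrow{\tau}P'\|Q'\{y/z\}$ and $Q\|P\xrightarrow{\tau}Q'\{y/z\}\|P'$. Substitutions $\sigma$ map names to names (capture-avoiding). A history is a dot-separated list of names annotated $o$ or $i$. $\sigma$ respects history $h$ if for all $h',h''$ with $h=h'\cdot x^o\cdot h''$, $x\sigma=x$ and $y\sigma\neq x$ for all $y\in\mathrm{fv}(h')$. Open bisimulation: a symmetric relation $\mathcal{R}$ on processes indexed by histories such that whenever $P\,\mathcal{R}^h\,Q$: (1) for all $\sigma$ respecting $h$, $P\sigma\,\mathcal{R}^{h\sigma}\,Q\sigma$; (2) if $P\xrightarrow{\alpha}P'$ with $\alpha$ being $\tau$ or $\overline{a}b$, there is $Q'$ with $Q\xrightarrow{\alpha}Q'$ and $P'\,\mathcal{R}^h\,Q'$; (3) if $P\xrightarrow{\overline{a}(x)}P'$ with $x$ fresh for $P,Q,h$, there is $Q'$ with $Q\xrightarrow{\overline{a}(x)}Q'$ and $P'\,\mathcal{R}^{h\cdot x^o}\,Q'$; (4) if $P\xrightarrow{a(x)}P'$ with $x$ fresh for $P,Q,h$, there is $Q'$ with $Q\xrightarrow{a(x)}Q'$ and $P'\,\mathcal{R}^{h\cdot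 x^i}\,Q'$. $P\sim Q$ iff some open bisimulation has $P\,\mathcal{R}^{x_0^i\cdots x_n^i}\,Q$ where $\mathrm{fv}(P)\cup\mathrm{fv}(Q)\subseteq\{x_0,\dots,x_n\}$. $\mathcal{OM}$ formulae: $\phi ::= \mathtt{tt}\mid\mathtt{ff}\mid\phi\wedge\phi\mid\phi\vee\phi\mid\phi\supset\phi\mid x=y\mid\langle\pi\rangle\phi\mid[\pi]\phi$ ($z$ bound in $\phi$ for modalities with $\overline{a}(z)$ or $a(z)$). Relation $P\vDash^h\phi$ ($z$ fresh for $P,h,\sigma$; $\alpha$ is $\tau$ or $\overline{a}b$): $\mathtt{tt}$ and $x=x$ always hold; $\mathtt{ff}$ never holds and $x=y$ never holds for distinct $x,y$; $\wedge,\vee$ pointwise; $P\vDash^h\phi_1\supset\phi_2$ iff for all $\sigma$ respecting $h$, $P\sigma\vDash^{h\sigma}\phi_1\sigma$ implies $P\sigma\vDash^{h\sigma}\phi_2\sigma$; $P\vDash^h\langle\alpha\rangle\phi$ iff $\exists Q$, $P\xrightarrow{\alpha}Q$, $Q\vDash^h\phi$; $P\vDash^h\langle\overline{a}(z)\rangle\phi$ iff $\exists Q$, $P\xrightarrow{\overline{a}(z)}Q$, $Q\vDash^{h\cdot z^o}\phi$; $P\vDash^h\langle a(z)\rangle\phi$ iff $\exists Q$, $P\xrightarrow{a(z)}Q$, $Q\vDash^{h\cdot z^i}\phi$; $P\vDash^h[\alpha]\phi$ iff for all $\sigma$ respecting $h$ and all $Q$, $P\sigma\xrightarrow{\alpha\sigma}Q$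 implies $Q\vDash^{h\sigma}\phi\sigma$; $P\vDash^h[\overline{a}(z)]\phi$ iff for all $\sigma$ respecting $h$ and all $Q$, $P\sigma\xrightarrow{\overline{a\sigma}(z)}Q$ implies $Q\vDash^{h\sigma\cdot z^o}\phi\sigma$; $P\vDash^h[a(z)]\phi$ iff for all $\sigma$ respecting $h$ and all $Q$, $P\sigma\xrightarrow{a\sigma(z)}Q$ implies $Q\vDash^{h\sigma\cdot z^i}\phi\sigma$. $P\vDash\phi$ iff $P\vDash^{x_0^i\cdots x_n^i}\phi$ with $\mathrm{fv}(P)\cup\mathrm{fv}(\phi)\subseteq\{x_0,\dots,x_n\}$. *)

theory Defs
  imports Main
begin

type_synonym name = nat

text \<open>
  Processes and formulae up to alpha-conversion are represented by de Bruijn terms: below \<open>d\<close>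
  binders, an index \<open>i < d\<close> is a bound occurrence and an index \<open>i \<ge> d\<close> is the free
  name \<open>i - d\<close>. Every term of the datatypes is thus exactly one alpha-equivalence class, and
  there are no ill-formed terms. All semantic rules below are stated with the named binders
  \<open>nu x P\<close> and \<open>pre \<pi> P\<close>.
\<close>

section \<open>Substitutions\<close>

definition is_subst :: "(name \<Rightarrow> name) \<Rightarrow> bool" where
  "is_subst \<sigma> \<longleftrightarrow> finite {x. \<sigma> x \<noteq> x}"

text \<open>A name is fresh for \<open>\<sigma>\<close> if it is neither moved by \<open>\<sigma>\<close> nor the image of another name.\<close>

definition fresh_subst :: "name \<Rightarrow> (name \<Rightarrow> name) \<Rightarrow> bool" where
  "fresh_subst z \<sigma> \<longleftrightarrow> (\<forall>x. \<sigma> x = z \<longleftrightarrow> x = z)"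

definition lift :: "(name \<Rightarrow> name) \<Rightarrow> name \<Rightarrow> name" where
  "lift \<sigma> n = (case n of 0 \<Rightarrow> 0 | Suc m \<Rightarrow> Suc (\<sigma> m))"

text \<open>\<open>bindn x\<close> turns the free name \<open>x\<close> into index 0 of a new outermost binder;
  \<open>instn z\<close> replaces index 0 by the name \<open>z\<close> when the outermost binder is removed.\<close>

definition bindn :: "name \<Rightarrow> name \<Rightarrow> name" where
  "bindn x n = (if n = x then 0 else Suc n)"

definition instn :: "name \<Rightarrow> name \<Rightarrow> name" where
  "instn z n = (case n of 0 \<Rightarrow> z | Suc m \<Rightarrow> m)"

section \<open>Processes\<close>

datatype act =
    Tau
  | Out name name   \<comment> \<open>free output\<close>
  | BOut name name  \<comment> \<open>bound output; the second name is the bound one\<close>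
  | In name name    \<comment> \<open>input; the second name is the bound one\<close>

fun n_act :: "act \<Rightarrow> name set" where
  "n_act Tau = {}"
| "n_act (Out x y) = {x, y}"
| "n_act (BOut x y) = {x, y}"
| "n_act (In x y) = {x, y}"

fun bn_act :: "act \<Rightarrow> name set" where
  "bn_act Tau = {}"
| "bn_act (Out x y) = {}"
| "bn_act (BOut x y) = {y}"
| "bn_act (In x y) = {y}"

datatype proc =
    PNil
  | Nu proc
  | PreTau proc
  | PreOut name name proc
  | PreBOut name proc
  | PreIn name proc
  | Match name name proc
  | Par proc proc
  | Sum proc proc

primrec fn :: "proc \<Rightarrow> name set" where
  "fn PNil = {}"
| "fn (Nu P) = Suc -` fn P"
| "fn (PreTau P) = fn P"
| "fn (PreOut x y P) = {x, y} \<union> fn P"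
| "fn (PreBOut x P) = {x} \<union> Suc -` fn P"
| "fn (PreIn x P) = {x} \<union> Suc -` fn P"
| "fn (Match x y P) = {x, y} \<union> fn P"
| "fn (Par P Q) = fn P \<union> fn Q"
| "fn (Sum P Q) = fn P \<union> fn Q"

text \<open>\<open>ren \<sigma> P\<close> is the result of applying the (capture-avoiding) substitution \<open>\<sigma>\<close>.\<close>

primrec ren :: "(name \<Rightarrow> name) \<Rightarrow> proc \<Rightarrow> proc" where
  "ren \<sigma> PNil = PNil"
| "ren \<sigma> (Nu P) = Nu (ren (lift \<sigma>) P)"
| "ren \<sigma> (PreTau P) = PreTau (ren \<sigma> P)"
| "ren \<sigma> (PreOut x y P) = PreOut (\<sigma> x) (\<sigma> y) (ren \<sigma> P)"
| "ren \<sigma> (PreBOut x P) = PreBOut (\<sigma> x) (ren (lift \<sigma>) P)"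
| "ren \<sigma> (PreIn x P) = PreIn (\<sigma> x) (ren (lift \<sigma>) P)"
| "ren \<sigma> (Match x y P) = Match (\<sigma> x) (\<sigma> y) (ren \<sigma> P)"
| "ren \<sigma> (Par P Q) = Par (ren \<sigma> P) (ren \<sigma> Q)"
| "ren \<sigma> (Sum P Q) = Sum (ren \<sigma> P) (ren \<sigma> Q)"

definition nu :: "name \<Rightarrow> proc \<Rightarrow> proc" where
  "nu x P = Nu (ren (bindn x) P)"

fun pre :: "act \<Rightarrow> proc \<Rightarrow> proc" where
  "pre Tau P = PreTau P"
| "pre (Out x y) P = PreOut x y P"
| "pre (BOut x y) P = PreBOut x (ren (bindn y) P)"
| "pre (In x y) P = PreIn x (ren (bindn y) P)"

section \<open>Late labelled transitions\<close>

inductive transition :: "proc \<Rightarrow> act \<Rightarrow> proc \<Rightarrow> bool" where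
  Pre:    "transition (pre \<pi> P) \<pi> P"
| Open:   "transition P (Out x z) Q \<Longrightarrow> x \<noteq> z \<Longrightarrow> transition (nu z P) (BOut x z) Q"
| Sum1:   "transition P \<pi> R \<Longrightarrow> transition (Sum P Q) \<pi> R"
| Sum2:   "transition P \<pi> R \<Longrightarrow> transition (Sum Q P) \<pi> R"
| Match:  "transition P \<pi> R \<Longrightarrow> transition (Match x x P) \<pi> R"
| Res:    "transition P \<pi> Q \<Longrightarrow> x \<notin> n_act \<pi> \<Longrightarrow> transition (nu x P) \<pi> (nu x Q)"
| Par1:   "transition P \<pi> Q \<Longrightarrow> bn_act \<pi> \<inter> fn R = {} \<Longrightarrow> transition (Par P R) \<pi> (Par Q R)"
| Par2:   "transition P \<pi> Q \<Longrightarrow> bn_act \<pi> \<inter> fn R = {} \<Longrightarrow> transition (Par R P) \<pi> (Par R Q)"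
| Close1: "transition P (BOut x z) P' \<Longrightarrow> transition Q (In x z) Q' \<Longrightarrow>
             transition (Par P Q) Tau (nu z (Par P' Q'))"
| Close2: "transition P (BOut x z) P' \<Longrightarrow> transition Q (In x z) Q' \<Longrightarrow>
             transition (Par Q P) Tau (nu z (Par Q' P'))"
| Comm1:  "transition P (Out x y) P' \<Longrightarrow> transition Q (In x z) Q' \<Longrightarrow>
             transition (Par P Q) Tau (Par P' (ren (id(z := y)) Q'))"
| Comm2:  "transition P (Out x y) P' \<Longrightarrow> transition Q (In x z) Q' \<Longrightarrow>
             transition (Par Q P) Tau (Par (ren (id(z := y)) Q') P')"

section \<open>Histories\<close>

datatype hname = OName name | IName name

type_synonym hist = "hname list"

primrec the_name :: "hname \<Rightarrow> name" where
  "the_name (OName x) = x"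
| "the_name (IName x) = x"

primrec hname_ren :: "(name \<Rightarrow> name) \<Rightarrow> hname \<Rightarrow> hname" where
  "hname_ren \<sigma> (OName x) = OName (\<sigma> x)"
| "hname_ren \<sigma> (IName x) = IName (\<sigma> x)"

definition hn :: "hist \<Rightarrow> name set" where
  "hn h = the_name ` set h"

definition hren :: "(name \<Rightarrow> name) \<Rightarrow> hist \<Rightarrow> hist" where
  "hren \<sigma> h = map (hname_ren \<sigma>) h"

definition respects_hist :: "(name \<Rightarrow> name) \<Rightarrow> hist \<Rightarrow> bool" where
  "respects_hist \<sigma> h \<longleftrightarrow>
     (\<forall>h1 x h2. h = h1 @ [OName x] @ h2 \<longrightarrow> \<sigma> x = x \<and> (\<forall>y\<in>hn h1. \<sigma> y \<noteq> x))"

section \<open>Open bisimilarity\<close>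

definition open_bisimulation :: "(hist \<Rightarrow> proc \<Rightarrow> proc \<Rightarrow> bool) \<Rightarrow> bool" where
  "open_bisimulation R \<longleftrightarrow>
     (\<forall>h P Q. R h P Q \<longrightarrow> R h Q P) \<and>
     (\<forall>h P Q. R h P Q \<longrightarrow>
        (\<forall>\<sigma>. is_subst \<sigma> \<and> respects_hist \<sigma> h \<longrightarrow> R (hren \<sigma> h) (ren \<sigma> P) (ren \<sigma> Q)) \<and>
        (\<forall>\<alpha> P'. (\<alpha> = Tau \<or> (\<exists>a b. \<alpha> = Out a b)) \<and> transition P \<alpha> P' \<longrightarrow>
           (\<exists>Q'. transition Q \<alpha> Q' \<and> R h P' Q')) \<and>
        (\<forall>a x P'. x \<notin> fn P \<union> fn Q \<union> hn h \<and> transition P (BOut a x) P' \<longrightarrow>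
           (\<exists>Q'. transition Q (BOut a x) Q' \<and> R (h @ [OName x]) P' Q')) \<and>
        (\<forall>a x P'. x \<notin> fn P \<union> fn Q \<union> hn h \<and> transition P (In a x) P' \<longrightarrow>
           (\<exists>Q'. transition Q (In a x) Q' \<and> R (h @ [IName x]) P' Q')))"

definition open_bisimilar :: "proc \<Rightarrow> proc \<Rightarrow> bool"  (infix "\<sim>" 50) where
  "P \<sim> Q \<longleftrightarrow>
     (\<exists>R xs. open_bisimulation R \<and> fn P \<union> fn Q \<subseteq> set xs \<and> R (map IName xs) P Q)"

section \<open>Formulae\<close>

datatype form =
    TT
  | FF
  | Conj form form
  | Disj form form
  | Imp form form
  | Eq name name
  | DiaTau form
  | DiaOut name name form
  | DiaBOut name form
  | DiaIn name form
  | BoxTau form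
  | BoxOut name name form
  | BoxBOut name form
  | BoxIn name form

primrec ffn :: "form \<Rightarrow> name set" where
  "ffn TT = {}"
| "ffn FF = {}"
| "ffn (Conj \<phi> \<psi>) = ffn \<phi> \<union> ffn \<psi>"
| "ffn (Disj \<phi> \<psi>) = ffn \<phi> \<union> ffn \<psi>"
| "ffn (Imp \<phi> \<psi>) = ffn \<phi> \<union> ffn \<psi>"
| "ffn (Eq x y) = {x, y}"
| "ffn (DiaTau \<phi>) = ffn \<phi>"
| "ffn (DiaOut x y \<phi>) = {x, y} \<union> ffn \<phi>"
| "ffn (DiaBOut x \<phi>) = {x} \<union> Suc -` ffn \<phi>"
| "ffn (DiaIn x \<phi>) = {x} \<union> Suc -` ffn \<phi>"
| "ffn (BoxTau \<phi>) = ffn \<phi>"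
| "ffn (BoxOut x y \<phi>) = {x, y} \<union> ffn \<phi>"
| "ffn (BoxBOut x \<phi>) = {x} \<union> Suc -` ffn \<phi>"
| "ffn (BoxIn x \<phi>) = {x} \<union> Suc -` ffn \<phi>"

primrec fren :: "(name \<Rightarrow> name) \<Rightarrow> form \<Rightarrow> form" where
  "fren \<sigma> TT = TT"
| "fren \<sigma> FF = FF"
| "fren \<sigma> (Conj \<phi> \<psi>) = Conj (fren \<sigma> \<phi>) (fren \<sigma> \<psi>)"
| "fren \<sigma> (Disj \<phi> \<psi>) = Disj (fren \<sigma> \<phi>) (fren \<sigma> \<psi>)"
| "fren \<sigma> (Imp \<phi> \<psi>) = Imp (fren \<sigma> \<phi>) (fren \<sigma> \<psi>)"
| "fren \<sigma> (Eq x y) = Eq (\<sigma> x) (\<sigma> y)"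
| "fren \<sigma> (DiaTau \<phi>) = DiaTau (fren \<sigma> \<phi>)"
| "fren \<sigma> (DiaOut x y \<phi>) = DiaOut (\<sigma> x) (\<sigma> y) (fren \<sigma> \<phi>)"
| "fren \<sigma> (DiaBOut x \<phi>) = DiaBOut (\<sigma> x) (fren (lift \<sigma>) \<phi>)"
| "fren \<sigma> (DiaIn x \<phi>) = DiaIn (\<sigma> x) (fren (lift \<sigma>) \<phi>)"
| "fren \<sigma> (BoxTau \<phi>) = BoxTau (fren \<sigma> \<phi>)"
| "fren \<sigma> (BoxOut x y \<phi>) = BoxOut (\<sigma> x) (\<sigma> y) (fren \<sigma> \<phi>)"
| "fren \<sigma> (BoxBOut x \<phi>) = BoxBOut (\<sigma> x) (fren (lift \<sigma>) \<phi>)"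
| "fren \<sigma> (BoxIn x \<phi>) = BoxIn (\<sigma> x) (fren (lift \<sigma>) \<phi>)"

fun dia :: "act \<Rightarrow> form \<Rightarrow> form" where
  "dia Tau \<phi> = DiaTau \<phi>"
| "dia (Out x y) \<phi> = DiaOut x y \<phi>"
| "dia (BOut x y) \<phi> = DiaBOut x (fren (bindn y) \<phi>)"
| "dia (In x y) \<phi> = DiaIn x (fren (bindn y) \<phi>)"

fun box :: "act \<Rightarrow> form \<Rightarrow> form" where
  "box Tau \<phi> = BoxTau \<phi>"
| "box (Out x y) \<phi> = BoxOut x y \<phi>"
| "box (BOut x y) \<phi> = BoxBOut x (fren (bindn y) \<phi>)"
| "box (In x y) \<phi> = BoxIn x (fren (bindn y) \<phi>)"

lemma size_fren [simp]: "size (fren \<sigma> \<phi>) = size \<phi>"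
  by (induction \<phi> arbitrary: \<sigma>) auto

section \<open>Satisfaction\<close>

text \<open>
  For a modality with a bound name, \<open>fren (instn z) \<phi>\<close> is the body of the alpha-variant whose
  bound name is \<open>z\<close>. The fresh \<open>z\<close> is quantified existentially under a diamond and
  universally under a box; the lemmas \<open>sat_dia_BOut\<close>, \<open>sat_dia_In\<close>,
  \<open>sat_box_BOut\<close> and \<open>sat_box_In\<close> below show that any single fresh name may be
  used instead, and give the clauses in named form.
\<close>

function sat :: "proc \<Rightarrow> hist \<Rightarrow> form \<Rightarrow> bool" where
  "sat P h TT \<longleftrightarrow> True"
| "sat P h FF \<longleftrightarrow> False"
| "sat P h (Conj \<phi> \<psi>) \<longleftrightarrow> sat P h \<phi> \<and> sat P h \<psi>"
| "sat P h (Disj \<phi> \<psi>) \<longleftrightarrow> sat P h \<phi> \<or> sat P h \<psi>"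
| "sat P h (Imp \<phi> \<psi>) \<longleftrightarrow>
     (\<forall>\<sigma>. is_subst \<sigma> \<and> respects_hist \<sigma> h \<longrightarrow>
        sat (ren \<sigma> P) (hren \<sigma> h) (fren \<sigma> \<phi>) \<longrightarrow> sat (ren \<sigma> P) (hren \<sigma> h) (fren \<sigma> \<psi>))"
| "sat P h (Eq x y) \<longleftrightarrow> x = y"
| "sat P h (DiaTau \<phi>) \<longleftrightarrow> (\<exists>Q. transition P Tau Q \<and> sat Q h \<phi>)"
| "sat P h (DiaOut a b \<phi>) \<longleftrightarrow> (\<exists>Q. transition P (Out a b) Q \<and> sat Q h \<phi>)"
| "sat P h (DiaBOut a \<phi>) \<longleftrightarrow>
     (\<exists>z Q. z \<notin> fn P \<union> hn h \<union> ffn (DiaBOut a \<phi>) \<and>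
        transition P (BOut a z) Q \<and> sat Q (h @ [OName z]) (fren (instn z) \<phi>))"
| "sat P h (DiaIn a \<phi>) \<longleftrightarrow>
     (\<exists>z Q. z \<notin> fn P \<union> hn h \<union> ffn (DiaIn a \<phi>) \<and>
        transition P (In a z) Q \<and> sat Q (h @ [IName z]) (fren (instn z) \<phi>))"
| "sat P h (BoxTau \<phi>) \<longleftrightarrow>
     (\<forall>\<sigma> Q. is_subst \<sigma> \<and> respects_hist \<sigma> h \<and> transition (ren \<sigma> P) Tau Q \<longrightarrow>
        sat Q (hren \<sigma> h) (fren \<sigma> \<phi>))"
| "sat P h (BoxOut a b \<phi>) \<longleftrightarrow>
     (\<forall>\<sigma> Q. is_subst \<sigma> \<and> respects_hist \<sigma> h \<and> transition (ren \<sigma> P) (Out (\<sigma> a) (\<sigma> b)) Q \<longrightarrow>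
        sat Q (hren \<sigma> h) (fren \<sigma> \<phi>))"
| "sat P h (BoxBOut a \<phi>) \<longleftrightarrow>
     (\<forall>\<sigma> z Q. is_subst \<sigma> \<and> respects_hist \<sigma> h \<and>
        z \<notin> fn P \<union> hn h \<union> ffn (BoxBOut a \<phi>) \<and> fresh_subst z \<sigma> \<and>
        transition (ren \<sigma> P) (BOut (\<sigma> a) z) Q \<longrightarrow>
        sat Q (hren \<sigma> h @ [OName z]) (fren \<sigma> (fren (instn z) \<phi>)))"
| "sat P h (BoxIn a \<phi>) \<longleftrightarrow>
     (\<forall>\<sigma> z Q. is_subst \<sigma> \<and> respects_hist \<sigma> h \<and>
        z \<notin> fn P \<union> hn h \<union> ffn (BoxIn a \<phi>) \<and> fresh_subst z \<sigma> \<and>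
        transition (ren \<sigma> P) (In (\<sigma> a) z) Q \<longrightarrow>
        sat Q (hren \<sigma> h @ [IName z]) (fren \<sigma> (fren (instn z) \<phi>)))"
  by pat_completeness auto
termination
  by (relation "measure (\<lambda>(P, h, \<phi>). size \<phi>)") auto

definition satisfies :: "proc \<Rightarrow> form \<Rightarrow> bool"  (infix "\<Turnstile>" 50) where
  "P \<Turnstile> \<phi> \<longleftrightarrow> (\<exists>xs. fn P \<union> ffn \<phi> \<subseteq> set xs \<and> sat P (map IName xs) \<phi>)"

section \<open>Binders and alpha-conversion\<close>

lemma lift_simps [simp]: "lift \<sigma> 0 = 0" "lift \<sigma> (Suc n) = Suc (\<sigma> n)"
  by (auto simp: lift_def)

lemma instn_simps [simp]: "instn z 0 = z" "instn z (Suc n) = n"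
  by (auto simp: instn_def)

lemma lift_comp: "lift \<sigma> \<circ> lift \<tau> = lift (\<sigma> \<circ> \<tau>)"
  by (auto simp: lift_def fun_eq_iff split: nat.split)

lemma lift_id: "lift id = id"
  by (auto simp: lift_def fun_eq_iff split: nat.split)

lemma lift_eq_Suc: "lift \<sigma> n = Suc m \<longleftrightarrow> (\<exists>k. n = Suc k \<and> \<sigma> k = m)"
  by (cases n) auto

lemma vimage_lift: "Suc -` (lift \<sigma> ` A) = \<sigma> ` (Suc -` A)"
  by (force simp: image_iff lift_eq_Suc eq_commute[of "Suc _" "lift _ _"])

lemma lift_cong: "\<forall>x\<in>Suc -` A. \<sigma> x = \<tau> x \<Longrightarrow> \<forall>x\<in>A. lift \<sigma> x = lift \<tau> x"
proof
  show "lift \<sigma> x = lift \<tau> x" if "\<forall>x\<in>Suc -` A. \<sigma> x = \<tau> x" "x \<in> A" for x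
    using that by (cases x) auto
qed

lemma ren_ren: "ren \<sigma> (ren \<tau> P) = ren (\<sigma> \<circ> \<tau>) P"
  by (induction P arbitrary: \<sigma> \<tau>) (auto simp: lift_comp)

lemma fren_fren: "fren \<sigma> (fren \<tau> \<phi>) = fren (\<sigma> \<circ> \<tau>) \<phi>"
  by (induction \<phi> arbitrary: \<sigma> \<tau>) (auto simp: lift_comp)

lemma ren_id: "ren id P = P"
  by (induction P) (simp_all add: lift_id lift_id[unfolded id_def])

lemma fren_id: "fren id \<phi> = \<phi>"
  by (induction \<phi>) (simp_all add: lift_id lift_id[unfolded id_def])

lemma ren_cong: "\<forall>x\<in>fn P. \<sigma> x = \<tau> x \<Longrightarrow> ren \<sigma> P = ren \<tau> P"
proof (induction P arbitrary: \<sigma> \<tau>)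
  case (Nu P)
  show ?case using Nu.prems by (auto intro!: Nu.IH lift_cong)
next
  case (PreBOut a P)
  show ?case using PreBOut.prems by (auto intro!: PreBOut.IH lift_cong)
next
  case (PreIn a P)
  show ?case using PreIn.prems by (auto intro!: PreIn.IH lift_cong)
qed (simp; blast)+

lemma fren_cong: "\<forall>x\<in>ffn \<phi>. \<sigma> x = \<tau> x \<Longrightarrow> fren \<sigma> \<phi> = fren \<tau> \<phi>"
proof (induction \<phi> arbitrary: \<sigma> \<tau>)
  case (DiaBOut a \<phi>)
  show ?case using DiaBOut.prems by (auto intro!: DiaBOut.IH lift_cong)
next
  case (DiaIn a \<phi>)
  show ?case using DiaIn.prems by (auto intro!: DiaIn.IH lift_cong)
next
  case (BoxBOut a \<phi>)
  show ?case using BoxBOut.prems by (auto intro!: BoxBOut.IH lift_cong)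
next
  case (BoxIn a \<phi>)
  show ?case using BoxIn.prems by (auto intro!: BoxIn.IH lift_cong)
qed (simp; blast)+

lemma fn_ren: "fn (ren \<sigma> P) = \<sigma> ` fn P"
  by (induction P arbitrary: \<sigma>) (simp_all add: vimage_lift image_Un)

lemma ffn_fren: "ffn (fren \<sigma> \<phi>) = \<sigma> ` ffn \<phi>"
  by (induction \<phi> arbitrary: \<sigma>) (simp_all add: vimage_lift image_Un)

lemma finite_fn: "finite (fn P)"
  by (induction P) (auto intro: finite_vimageI)

lemma finite_ffn: "finite (ffn \<phi>)"
  by (induction \<phi>) (auto intro: finite_vimageI)

lemma id_upd: "id(x := x) = id"
  by (simp add: fun_eq_iff)

lemma instn_bindn: "instn z \<circ> bindn x = id(x := z)"
  by (auto simp: bindn_def fun_eq_iff)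

lemma vimage_bindn: "Suc -` (bindn x ` A) = A - {x}"
  by (auto simp: bindn_def image_iff)

lemma bindn_instn: "Suc z \<notin> A \<Longrightarrow> \<forall>x\<in>A. (bindn z \<circ> instn z) x = id x"
  by (auto simp: bindn_def instn_def split: nat.splits)

lemma bindn_upd: "x \<notin> A \<Longrightarrow> \<forall>n\<in>A. (bindn x \<circ> id(y := x)) n = bindn y n"
  by (auto simp: bindn_def)

lemma lift_bindn: "\<forall>x. \<sigma> x = w \<longleftrightarrow> x = z \<Longrightarrow> lift \<sigma> \<circ> bindn z = bindn w \<circ> \<sigma>"
  by (auto simp: bindn_def fun_eq_iff)

lemma lift_bindn_inj: "inj \<sigma> \<Longrightarrow> lift \<sigma> \<circ> bindn z = bindn (\<sigma> z) \<circ> \<sigma>"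
  by (rule lift_bindn) (simp add: inj_eq)

lemma instn_lift: "instn (\<sigma> w) \<circ> lift \<sigma> = \<sigma> \<circ> instn w"
  by (auto simp: fun_eq_iff instn_def lift_def split: nat.splits)

lemma ren_bindn_instn: "Suc z \<notin> fn P \<Longrightarrow> ren (bindn z) (ren (instn z) P) = P"
  unfolding ren_ren by (rule trans[OF ren_cong[OF bindn_instn] ren_id])

lemma fren_bindn_instn: "Suc z \<notin> ffn \<phi> \<Longrightarrow> fren (bindn z) (fren (instn z) \<phi>) = \<phi>"
  unfolding fren_fren by (rule trans[OF fren_cong[OF bindn_instn] fren_id])

lemma ren_bindn_eq_iff:
  "ren (bindn x) P = ren (bindn y) Q \<longleftrightarrow>
     (x = y \<and> P = Q) \<or> (x \<noteq> y \<and> x \<notin> fn Q \<and> P = ren (id(y := x)) Q)" (is "?L \<longleftrightarrow> ?R")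
proof
  assume L: ?L
  then have "ren (instn x) (ren (bindn x) P) = ren (instn x) (ren (bindn y) Q)" by simp
  then have P: "P = ren (id(y := x)) Q"
    by (simp add: ren_ren instn_bindn id_upd ren_id)
  from L have "Suc -` fn (ren (bindn x) P) = Suc -` fn (ren (bindn y) Q)" by simp
  then have "fn P - {x} = fn Q - {y}" by (simp add: fn_ren vimage_bindn)
  then have "x \<notin> fn Q - {y}" by blast
  with P show ?R by (cases "x = y") (simp_all add: id_upd ren_id)
next
  assume ?R
  then show ?L
  proof (elim disjE conjE)
    assume "x \<notin> fn Q" "P = ren (id(y := x)) Q"
    then show ?L using ren_cong[OF bindn_upd] by (simp only: ren_ren)
  qed simp
qed

lemma fren_bindn_eq_iff:
  "fren (bindn x) \<phi> = fren (bindn y) \<psi> \<longleftrightarrow>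
     (x = y \<and> \<phi> = \<psi>) \<or> (x \<noteq> y \<and> x \<notin> ffn \<psi> \<and> \<phi> = fren (id(y := x)) \<psi>)" (is "?L \<longleftrightarrow> ?R")
proof
  assume L: ?L
  then have "fren (instn x) (fren (bindn x) \<phi>) = fren (instn x) (fren (bindn y) \<psi>)" by simp
  then have P: "\<phi> = fren (id(y := x)) \<psi>"
    by (simp add: fren_fren instn_bindn id_upd fren_id)
  from L have "Suc -` ffn (fren (bindn x) \<phi>) = Suc -` ffn (fren (bindn y) \<psi>)" by simp
  then have "ffn \<phi> - {x} = ffn \<psi> - {y}" by (simp add: ffn_fren vimage_bindn)
  then have "x \<notin> ffn \<psi> - {y}" by blast
  with P show ?R by (cases "x = y") (simp_all add: id_upd fren_id)
next
  assume ?R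
  then show ?L
  proof (elim disjE conjE)
    assume "x \<notin> ffn \<psi>" "\<phi> = fren (id(y := x)) \<psi>"
    then show ?L using fren_cong[OF bindn_upd] by (simp only: fren_fren)
  qed simp
qed

text \<open>Named binders agree exactly up to alpha-conversion, every term is built from them with any
  sufficiently fresh bound name, and free names and substitution are as expected.\<close>

lemma nu_eq_iff:
  "nu x P = nu y Q \<longleftrightarrow>
     (x = y \<and> P = Q) \<or> (x \<noteq> y \<and> x \<notin> fn Q \<and> P = ren (id(y := x)) Q)"
  by (simp add: nu_def ren_bindn_eq_iff)

lemma Nu_named: "z \<notin> fn (Nu P) \<Longrightarrow> Nu P = nu z (ren (instn z) P)"
  by (simp add: nu_def ren_bindn_instn)

lemma PreBOut_named: "z \<notin> Suc -` fn P \<Longrightarrow> PreBOut x P = pre (BOut x z) (ren (instn z) P)"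
  by (simp add: ren_bindn_instn)

lemma PreIn_named: "z \<notin> Suc -` fn P \<Longrightarrow> PreIn x P = pre (In x z) (ren (instn z) P)"
  by (simp add: ren_bindn_instn)

lemma fn_named:
  "fn (nu x P) = fn P - {x}"
  "fn (pre \<pi> P) = (n_act \<pi> - bn_act \<pi>) \<union> (fn P - bn_act \<pi>)
     \<union> (case \<pi> of BOut a z \<Rightarrow> {a} | In a z \<Rightarrow> {a} | _ \<Rightarrow> {})"
  by (cases \<pi>; auto simp: nu_def fn_ren vimage_bindn)+

lemma ren_nu: "fresh_subst z \<sigma> \<Longrightarrow> ren \<sigma> (nu z P) = nu z (ren \<sigma> P)"
  by (simp add: nu_def ren_ren lift_bindn fresh_subst_def)

lemma ren_pre_BOut:
  "fresh_subst z \<sigma> \<Longrightarrow> ren \<sigma> (pre (BOut x z) P) = pre (BOut (\<sigma> x) z) (ren \<sigma> P)"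
  by (simp add: ren_ren lift_bindn fresh_subst_def)

lemma ren_pre_In:
  "fresh_subst z \<sigma> \<Longrightarrow> ren \<sigma> (pre (In x z) P) = pre (In (\<sigma> x) z) (ren \<sigma> P)"
  by (simp add: ren_ren lift_bindn fresh_subst_def)

lemma DiaBOut_named: "z \<notin> Suc -` ffn \<phi> \<Longrightarrow> DiaBOut x \<phi> = dia (BOut x z) (fren (instn z) \<phi>)"
  by (simp add: fren_bindn_instn)

lemma DiaIn_named: "z \<notin> Suc -` ffn \<phi> \<Longrightarrow> DiaIn x \<phi> = dia (In x z) (fren (instn z) \<phi>)"
  by (simp add: fren_bindn_instn)

lemma BoxBOut_named: "z \<notin> Suc -` ffn \<phi> \<Longrightarrow> BoxBOut x \<phi> = box (BOut x z) (fren (instn z) \<phi>)"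
  by (simp add: fren_bindn_instn)

lemma BoxIn_named: "z \<notin> Suc -` ffn \<phi> \<Longrightarrow> BoxIn x \<phi> = box (In x z) (fren (instn z) \<phi>)"
  by (simp add: fren_bindn_instn)

section \<open>Equivariance\<close>

fun act_ren :: "(name \<Rightarrow> name) \<Rightarrow> act \<Rightarrow> act" where
  "act_ren \<sigma> Tau = Tau"
| "act_ren \<sigma> (Out x y) = Out (\<sigma> x) (\<sigma> y)"
| "act_ren \<sigma> (BOut x y) = BOut (\<sigma> x) (\<sigma> y)"
| "act_ren \<sigma> (In x y) = In (\<sigma> x) (\<sigma> y)"

lemma n_act_ren: "n_act (act_ren \<sigma> \<pi>) = \<sigma> ` n_act \<pi>"
  by (cases \<pi>) auto

lemma bn_act_ren: "bn_act (act_ren \<sigma> \<pi>) = \<sigma> ` bn_act \<pi>"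
  by (cases \<pi>) auto

lemma ren_nu_inj: "inj p \<Longrightarrow> ren p (nu z P) = nu (p z) (ren p P)"
  by (simp add: nu_def ren_ren lift_bindn_inj)

lemma ren_pre_inj: "inj p \<Longrightarrow> ren p (pre \<pi> P) = pre (act_ren p \<pi>) (ren p P)"
  by (cases \<pi>) (simp_all add: ren_ren lift_bindn_inj)

lemma ren_upd_inj: "inj p \<Longrightarrow> ren p (ren (id(z := y)) Q) = ren (id(p z := p y)) (ren p Q)"
  unfolding ren_ren by (rule ren_cong) (auto simp: inj_eq)

lemma transition_ren:
  assumes "transition P \<pi> Q" "inj p"
  shows "transition (ren p P) (act_ren p \<pi>) (ren p Q)"
  using assms
proof (induction rule: transition.induct)
  case (Pre \<pi> P)
  then show ?case by (simp add: ren_pre_inj transition.Pre)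
next
  case (Open P x z Q)
  then show ?case by (simp add: ren_nu_inj transition.Open inj_eq)
next
  case (Res P \<pi> Q x)
  then show ?case by (simp add: ren_nu_inj transition.Res n_act_ren inj_image_mem_iff)
next
  case (Par1 P \<pi> Q R)
  then show ?case
    by (simp add: transition.Par1 bn_act_ren fn_ren flip: image_Int)
next
  case (Par2 P \<pi> Q R)
  then show ?case
    by (simp add: transition.Par2 bn_act_ren fn_ren flip: image_Int)
next
  case (Close1 P x z P' Q Q')
  then show ?case by (auto simp: ren_nu_inj intro: transition.Close1)
next
  case (Close2 P x z P' Q Q')
  then show ?case by (auto simp: ren_nu_inj intro: transition.Close2)
next
  case (Comm1 P x y P' Q z Q')
  then show ?case by (auto simp: ren_upd_inj intro: transition.Comm1)
next
  case (Comm2 P x y P' Q z Q')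
  then show ?case by (auto simp: ren_upd_inj intro: transition.Comm2)
qed (auto intro: transition.intros)

lemma hname_ren_comp: "hname_ren \<sigma> (hname_ren \<tau> a) = hname_ren (\<sigma> \<circ> \<tau>) a"
  by (cases a) auto

lemma the_name_hname_ren: "the_name (hname_ren \<sigma> a) = \<sigma> (the_name a)"
  by (cases a) auto

lemma hren_hren: "hren \<sigma> (hren \<tau> h) = hren (\<sigma> \<circ> \<tau>) h"
  by (simp add: hren_def hname_ren_comp)

lemma hren_append: "hren \<sigma> (h1 @ h2) = hren \<sigma> h1 @ hren \<sigma> h2"
  by (simp add: hren_def)

lemma hn_hren: "hn (hren \<sigma> h) = \<sigma> ` hn h"
  by (simp add: hn_def hren_def image_image the_name_hname_ren)

lemma hren_cong: "\<forall>x\<in>hn h. \<sigma> x = \<tau> x \<Longrightarrow> hren \<sigma> h = hren \<tau> h"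
  by (auto simp: hn_def hren_def) (metis hname.exhaust hname_ren.simps(1,2) the_name.simps(1,2))

lemma hren_id: "hren id h = h"
proof -
  have "hname_ren id = id" by (rule ext, case_tac x) auto
  then show ?thesis by (simp add: hren_def)
qed

lemma finite_hn: "finite (hn h)"
  by (simp add: hn_def)

lemma conj_subst:
  assumes p: "bij p" and \<sigma>: "is_subst \<sigma>" "respects_hist \<sigma> (hren p h)"
  obtains \<tau> where "is_subst \<tau>" "respects_hist \<tau> h" "\<sigma> \<circ> p = p \<circ> \<tau>"
    "\<And>w. fresh_subst (p w) \<sigma> \<Longrightarrow> fresh_subst w \<tau>"
proof
  let ?\<tau> = "inv p \<circ> \<sigma> \<circ> p"
  have ip: "p (inv p x) = x" "inv p (p x) = x" for x
    using p by (simp_all add: bij_is_surj surj_f_inv_f bij_is_inj)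
  have "{x. ?\<tau> x \<noteq> x} \<subseteq> inv p ` {x. \<sigma> x \<noteq> x}"
    by (auto simp: image_iff) (metis ip)
  then show "is_subst ?\<tau>" using \<sigma>(1) unfolding is_subst_def
    by (meson finite_imageI finite_subset)
  show "\<sigma> \<circ> p = p \<circ> ?\<tau>" by (simp add: fun_eq_iff ip)
  show "respects_hist ?\<tau> h" unfolding respects_hist_def
  proof (intro allI impI)
    fix h1 x h2 assume "h = h1 @ [OName x] @ h2"
    then have "hren p h = hren p h1 @ [OName (p x)] @ hren p h2"
      by (simp add: hren_def)
    with \<sigma>(2) have "\<sigma> (p x) = p x \<and> (\<forall>y\<in>hn (hren p h1). \<sigma> y \<noteq> p x)"
      unfolding respects_hist_def by blast
    then show "?\<tau> x = x \<and> (\<forall>y\<in>hn h1. ?\<tau> y \<noteq> x)"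
      by (auto simp: hn_hren ip)
  qed
  show "fresh_subst w ?\<tau>" if "fresh_subst (p w) \<sigma>" for w
    using that unfolding fresh_subst_def by (metis comp_apply ip)
qed

lemma fresh_bij:
  assumes "bij p"
  shows "p w \<notin> fn (ren p P) \<union> hn (hren p h) \<union> ffn (fren p \<phi>) \<longleftrightarrow> w \<notin> fn P \<union> hn h \<union> ffn \<phi>"
  using assms by (simp add: fn_ren ffn_fren hn_hren inj_image_mem_iff bij_is_inj)

lemma sat_ren_step:
  assumes p: "bij p" and s: "sat P h \<phi>"
    and IH: "\<And>\<psi> P h. size \<psi> < size \<phi> \<Longrightarrow>
      sat (ren p P) (hren p h) (fren p \<psi>) \<longleftrightarrow> sat P h \<psi>"
  shows "sat (ren p P) (hren p h) (fren p \<phi>)"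
proof -
  have inj: "inj p" using p by (rule bij_is_inj)
  note tr = transition_ren[OF _ inj]
  have bwd: "\<exists>Q'. transition P \<pi> Q' \<and> Q = ren p Q'"
    if "transition (ren p P) (act_ren p \<pi>) Q" for P \<pi> Q
  proof -
    have "inj (inv p)" using p by (simp add: bij_imp_bij_inv bij_is_inj)
    from transition_ren[OF that this]
    have t: "transition (ren (inv p \<circ> p) P) (act_ren (inv p) (act_ren p \<pi>)) (ren (inv p) Q)"
      by (simp add: ren_ren)
    moreover have "act_ren (inv p) (act_ren p \<pi>) = \<pi>" by (cases \<pi>) (simp_all add: inj)
    moreover have "Q = ren p (ren (inv p) Q)"
      by (simp add: ren_ren surj_iff[THEN iffD1, OF bij_is_surj[OF p]] ren_id)
    ultimately show ?thesis by (auto simp: inj ren_id)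
  qed
  show ?thesis
  proof (cases \<phi>)
    case (Imp \<phi>1 \<phi>2)
    show ?thesis unfolding Imp fren.simps sat.simps
    proof (intro allI impI, elim conjE)
      fix \<sigma> assume \<sigma>: "is_subst \<sigma>" "respects_hist \<sigma> (hren p h)"
        and a: "sat (ren \<sigma> (ren p P)) (hren \<sigma> (hren p h)) (fren \<sigma> (fren p \<phi>1))"
      from conj_subst[OF p \<sigma>] obtain \<tau>
        where \<tau>: "is_subst \<tau>" "respects_hist \<tau> h" "\<sigma> \<circ> p = p \<circ> \<tau>" by metis
      from a have "sat (ren p (ren \<tau> P)) (hren p (hren \<tau> h)) (fren p (fren \<tau> \<phi>1))"
        by (simp add: ren_ren fren_fren hren_hren \<tau>(3))
      then have "sat (ren \<tau> P) (hren \<tau> h) (fren \<tau> \<phi>1)" by (subst (asm) IH) (simp_all add: Imp)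
      with s \<tau> have "sat (ren \<tau> P) (hren \<tau> h) (fren \<tau> \<phi>2)" by (simp add: Imp)
      then have "sat (ren p (ren \<tau> P)) (hren p (hren \<tau> h)) (fren p (fren \<tau> \<phi>2))"
        by (subst IH) (simp_all add: Imp)
      then show "sat (ren \<sigma> (ren p P)) (hren \<sigma> (hren p h)) (fren \<sigma> (fren p \<phi>2))"
        by (simp add: ren_ren fren_fren hren_hren \<tau>(3))
    qed
  next
    case (DiaTau \<psi>)
    with s obtain Q where "transition P Tau Q" "sat Q h \<psi>" by auto
    then show ?thesis using tr[of P Tau Q] IH[of \<psi>] by (auto simp: DiaTau)
  next
    case (DiaOut a b \<psi>)
    with s obtain Q where "transition P (Out a b) Q" "sat Q h \<psi>" by auto
    then show ?thesis using tr[of P "Out a b" Q] IH[of \<psi>] by (auto simp: DiaOut)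
  next
    case (DiaBOut a \<psi>)
    with s obtain z Q where z: "z \<notin> fn P \<union> hn h \<union> ffn \<phi>"
      and Q: "transition P (BOut a z) Q" "sat Q (h @ [OName z]) (fren (instn z) \<psi>)"
      by (auto simp del: ffn.simps)
    from Q(2) have "sat (ren p Q) (hren p (h @ [OName z])) (fren p (fren (instn z) \<psi>))"
      by (subst IH) (simp_all add: DiaBOut)
    then have "sat (ren p Q) (hren p h @ [OName (p z)]) (fren (instn (p z)) (fren (lift p) \<psi>))"
      by (simp add: fren_fren instn_lift hren_def)
    moreover have "p z \<notin> fn (ren p P) \<union> hn (hren p h) \<union> ffn (fren p \<phi>)"
      using z fresh_bij[OF p] by blast
    ultimately show ?thesis using tr[OF Q(1)]
      unfolding DiaBOut fren.simps sat.simps act_ren.simps by blast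
  next
    case (DiaIn a \<psi>)
    with s obtain z Q where z: "z \<notin> fn P \<union> hn h \<union> ffn \<phi>"
      and Q: "transition P (In a z) Q" "sat Q (h @ [IName z]) (fren (instn z) \<psi>)"
      by (auto simp del: ffn.simps)
    from Q(2) have "sat (ren p Q) (hren p (h @ [IName z])) (fren p (fren (instn z) \<psi>))"
      by (subst IH) (simp_all add: DiaIn)
    then have "sat (ren p Q) (hren p h @ [IName (p z)]) (fren (instn (p z)) (fren (lift p) \<psi>))"
      by (simp add: fren_fren instn_lift hren_def)
    moreover have "p z \<notin> fn (ren p P) \<union> hn (hren p h) \<union> ffn (fren p \<phi>)"
      using z fresh_bij[OF p] by blast
    ultimately show ?thesis using tr[OF Q(1)]
      unfolding DiaIn fren.simps sat.simps act_ren.simps by blast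
  next
    case (BoxTau \<psi>)
    show ?thesis unfolding BoxTau fren.simps sat.simps
    proof (intro allI impI, elim conjE)
      fix \<sigma> Q assume \<sigma>: "is_subst \<sigma>" "respects_hist \<sigma> (hren p h)"
        and t: "transition (ren \<sigma> (ren p P)) Tau Q"
      from conj_subst[OF p \<sigma>] obtain \<tau>
        where \<tau>: "is_subst \<tau>" "respects_hist \<tau> h" "\<sigma> \<circ> p = p \<circ> \<tau>" by metis
      from t have "transition (ren p (ren \<tau> P)) (act_ren p Tau) Q"
        by (simp add: ren_ren \<tau>(3))
      from bwd[OF this] obtain Q' where Q': "transition (ren \<tau> P) Tau Q'" "Q = ren p Q'" by auto
      with s \<tau> have "sat Q' (hren \<tau> h) (fren \<tau> \<psi>)" by (simp add: BoxTau)
      then have "sat (ren p Q') (hren p (hren \<tau> h)) (fren p (fren \<tau> \<psi>))"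
        by (subst IH) (simp_all add: BoxTau)
      then show "sat Q (hren \<sigma> (hren p h)) (fren \<sigma> (fren p \<psi>))"
        by (simp add: fren_fren hren_hren \<tau>(3) Q'(2))
    qed
  next
    case (BoxOut a b \<psi>)
    show ?thesis unfolding BoxOut fren.simps sat.simps
    proof (intro allI impI, elim conjE)
      fix \<sigma> Q assume \<sigma>: "is_subst \<sigma>" "respects_hist \<sigma> (hren p h)"
        and t: "transition (ren \<sigma> (ren p P)) (Out (\<sigma> (p a)) (\<sigma> (p b))) Q"
      from conj_subst[OF p \<sigma>] obtain \<tau>
        where \<tau>: "is_subst \<tau>" "respects_hist \<tau> h" "\<sigma> \<circ> p = p \<circ> \<tau>" by metis
      have [simp]: "\<sigma> (p x) = p (\<tau> x)" for x using \<tau>(3) by (metis comp_apply)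
      from t have "transition (ren p (ren \<tau> P)) (act_ren p (Out (\<tau> a) (\<tau> b))) Q"
        by (simp add: ren_ren \<tau>(3))
      from bwd[OF this] obtain Q'
        where Q': "transition (ren \<tau> P) (Out (\<tau> a) (\<tau> b)) Q'" "Q = ren p Q'" by auto
      with s \<tau> have "sat Q' (hren \<tau> h) (fren \<tau> \<psi>)" by (simp add: BoxOut)
      then have "sat (ren p Q') (hren p (hren \<tau> h)) (fren p (fren \<tau> \<psi>))"
        by (subst IH) (simp_all add: BoxOut)
      then show "sat Q (hren \<sigma> (hren p h)) (fren \<sigma> (fren p \<psi>))"
        by (simp add: fren_fren hren_hren \<tau>(3) Q'(2))
    qed
  next
    case (BoxBOut a \<psi>)
    show ?thesis unfolding BoxBOut fren.simps sat.simps
    proof (intro allI impI, elim conjE)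
      fix \<sigma> z Q assume \<sigma>: "is_subst \<sigma>" "respects_hist \<sigma> (hren p h)"
        and z: "z \<notin> fn (ren p P) \<union> hn (hren p h) \<union> ffn (BoxBOut (p a) (fren (lift p) \<psi>))"
        and f: "fresh_subst z \<sigma>"
        and t: "transition (ren \<sigma> (ren p P)) (BOut (\<sigma> (p a)) z) Q"
      obtain w where w: "z = p w" using p by (metis bij_pointE)
      from conj_subst[OF p \<sigma>] obtain \<tau>
        where \<tau>: "is_subst \<tau>" "respects_hist \<tau> h" "\<sigma> \<circ> p = p \<circ> \<tau>" and fw: "fresh_subst w \<tau>"
        using f unfolding w by metis
      have [simp]: "\<sigma> (p x) = p (\<tau> x)" for x using \<tau>(3) by (metis comp_apply)
      from t have "transition (ren p (ren \<tau> P)) (act_ren p (BOut (\<tau> a) w)) Q"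
        by (simp add: ren_ren \<tau>(3) w)
      from bwd[OF this] obtain Q'
        where Q': "transition (ren \<tau> P) (BOut (\<tau> a) w) Q'" "Q = ren p Q'" by auto
      have "w \<notin> fn P \<union> hn h \<union> ffn \<phi>"
        using z fresh_bij[OF p, of w P h \<phi>] by (simp add: BoxBOut w)
      with s \<tau> fw Q' have "sat Q' (hren \<tau> h @ [OName w]) (fren \<tau> (fren (instn w) \<psi>))"
        unfolding BoxBOut sat.simps by blast
      then have "sat (ren p Q') (hren p (hren \<tau> h @ [OName w])) (fren p (fren \<tau> (fren (instn w) \<psi>)))"
        by (subst IH) (simp_all add: BoxBOut)
      moreover have "p \<circ> (\<tau> \<circ> instn w) = \<sigma> \<circ> (instn z \<circ> lift p)"
        by (simp add: w instn_lift fun_eq_iff)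
      ultimately
      show "sat Q (hren \<sigma> (hren p h) @ [OName z]) (fren \<sigma> (fren (instn z) (fren (lift p) \<psi>)))"
        by (simp add: fren_fren hren_hren \<tau>(3) Q'(2) hren_append)
           (simp add: hren_def w)
    qed
  next
    case (BoxIn a \<psi>)
    show ?thesis unfolding BoxIn fren.simps sat.simps
    proof (intro allI impI, elim conjE)
      fix \<sigma> z Q assume \<sigma>: "is_subst \<sigma>" "respects_hist \<sigma> (hren p h)"
        and z: "z \<notin> fn (ren p P) \<union> hn (hren p h) \<union> ffn (BoxIn (p a) (fren (lift p) \<psi>))"
        and f: "fresh_subst z \<sigma>"
        and t: "transition (ren \<sigma> (ren p P)) (In (\<sigma> (p a)) z) Q"
      obtain w where w: "z = p w" using p by (metis bij_pointE)
      from conj_subst[OF p \<sigma>] obtain \<tau>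
        where \<tau>: "is_subst \<tau>" "respects_hist \<tau> h" "\<sigma> \<circ> p = p \<circ> \<tau>" and fw: "fresh_subst w \<tau>"
        using f unfolding w by metis
      have [simp]: "\<sigma> (p x) = p (\<tau> x)" for x using \<tau>(3) by (metis comp_apply)
      from t have "transition (ren p (ren \<tau> P)) (act_ren p (In (\<tau> a) w)) Q"
        by (simp add: ren_ren \<tau>(3) w)
      from bwd[OF this] obtain Q'
        where Q': "transition (ren \<tau> P) (In (\<tau> a) w) Q'" "Q = ren p Q'" by auto
      have "w \<notin> fn P \<union> hn h \<union> ffn \<phi>"
        using z fresh_bij[OF p, of w P h \<phi>] by (simp add: BoxIn w)
      with s \<tau> fw Q' have "sat Q' (hren \<tau> h @ [IName w]) (fren \<tau> (fren (instn w) \<psi>))"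
        unfolding BoxIn sat.simps by blast
      then have "sat (ren p Q') (hren p (hren \<tau> h @ [IName w])) (fren p (fren \<tau> (fren (instn w) \<psi>)))"
        by (subst IH) (simp_all add: BoxIn)
      moreover have "p \<circ> (\<tau> \<circ> instn w) = \<sigma> \<circ> (instn z \<circ> lift p)"
        by (simp add: w instn_lift fun_eq_iff)
      ultimately
      show "sat Q (hren \<sigma> (hren p h) @ [IName z]) (fren \<sigma> (fren (instn z) (fren (lift p) \<psi>)))"
        by (simp add: fren_fren hren_hren \<tau>(3) Q'(2) hren_append)
           (simp add: hren_def w)
    qed
  qed (use s IH in \<open>auto simp: inj_eq[OF inj]\<close>)
qed

lemma sat_ren: "bij p \<Longrightarrow> sat (ren p P) (hren p h) (fren p \<phi>) \<longleftrightarrow> sat P h \<phi>"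
proof (induction "size \<phi>" arbitrary: \<phi> p P h rule: less_induct)
  case less
  let ?q = "inv p"
  have q: "bij ?q" using less.prems by (rule bij_imp_bij_inv)
  have qp: "?q \<circ> p = id" using less.prems by (simp add: bij_is_inj)
  show ?case
  proof
    assume "sat P h \<phi>"
    with less.prems show "sat (ren p P) (hren p h) (fren p \<phi>)"
      by (rule sat_ren_step) (rule less.hyps[OF _ less.prems])
  next
    assume "sat (ren p P) (hren p h) (fren p \<phi>)"
    with q have "sat (ren ?q (ren p P)) (hren ?q (hren p h)) (fren ?q (fren p \<phi>))"
      by (rule sat_ren_step) (rule less.hyps[OF _ q], simp)
    then show "sat P h \<phi>"
      by (simp add: ren_ren fren_fren hren_hren qp ren_id fren_id hren_id)
  qed
qed

section \<open>Satisfaction for modalities with a named binder\<close>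

definition swapn :: "name \<Rightarrow> name \<Rightarrow> name \<Rightarrow> name" where
  "swapn x y = id(x := y, y := x)"

lemma swapn_simps [simp]: "swapn x y x = y" "swapn x y y = x"
  "z \<noteq> x \<Longrightarrow> z \<noteq> y \<Longrightarrow> swapn x y z = z"
  by (auto simp: swapn_def)

lemma bij_swapn: "bij (swapn x y)"
  by (rule o_bij[of "swapn x y"]) (auto simp: swapn_def fun_eq_iff)

lemma swapn_eq_id: "x \<notin> A \<Longrightarrow> y \<notin> A \<Longrightarrow> \<forall>n\<in>A. swapn x y n = id n"
  by (auto simp: swapn_def)

lemma swapn_id:
  "x \<notin> fn P \<Longrightarrow> y \<notin> fn P \<Longrightarrow> ren (swapn x y) P = P"
  "x \<notin> ffn \<phi> \<Longrightarrow> y \<notin> ffn \<phi> \<Longrightarrow> fren (swapn x y) \<phi> = \<phi>"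
  "x \<notin> hn h \<Longrightarrow> y \<notin> hn h \<Longrightarrow> hren (swapn x y) h = h"
  by (rule trans[OF ren_cong[OF swapn_eq_id] ren_id], assumption+)
     (rule trans[OF fren_cong[OF swapn_eq_id] fren_id], assumption+,
      rule trans[OF hren_cong[OF swapn_eq_id] hren_id], assumption+)

lemma fren_instn_bindn: "fren (instn z) (fren (bindn z) \<phi>) = \<phi>"
  by (simp add: fren_fren instn_bindn id_upd fren_id)

lemma fren_instn_swap:
  assumes "z \<notin> Suc -` ffn \<psi>" "w \<notin> Suc -` ffn \<psi>"
  shows "fren (swapn z w) (fren (instn z) \<psi>) = fren (instn w) \<psi>"
  unfolding fren_fren using assms
  by (intro fren_cong ballI) (auto simp: instn_def swapn_def split: nat.splits)

lemma sat_DiaBOut_fresh: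
  assumes w: "w \<notin> fn P \<union> hn h \<union> ffn (DiaBOut a \<psi>)"
  shows "sat P h (DiaBOut a \<psi>) \<longleftrightarrow>
    (\<exists>Q. transition P (BOut a w) Q \<and> sat Q (h @ [OName w]) (fren (instn w) \<psi>))"
proof
  assume "sat P h (DiaBOut a \<psi>)"
  then obtain z Q where z: "z \<notin> fn P \<union> hn h \<union> ffn (DiaBOut a \<psi>)"
    and t: "transition P (BOut a z) Q" and s: "sat Q (h @ [OName z]) (fren (instn z) \<psi>)"
    unfolding sat.simps by blast
  have "transition P (BOut a w) (ren (swapn z w) Q)"
    using transition_ren[OF t bij_is_inj[OF bij_swapn[of z w]]] z w by (simp add: swapn_id)
  moreover have "sat (ren (swapn z w) Q) (h @ [OName w]) (fren (instn w) \<psi>)"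
    using sat_ren[OF bij_swapn[of z w], of Q "h @ [OName z]" "fren (instn z) \<psi>"] s z w
    by (simp add: hren_append swapn_id fren_instn_swap) (simp add: hren_def)
  ultimately show "\<exists>Q. transition P (BOut a w) Q \<and> sat Q (h @ [OName w]) (fren (instn w) \<psi>)"
    by blast
next
  assume "\<exists>Q. transition P (BOut a w) Q \<and> sat Q (h @ [OName w]) (fren (instn w) \<psi>)"
  then show "sat P h (DiaBOut a \<psi>)" unfolding sat.simps using w by blast
qed

lemma sat_DiaIn_fresh:
  assumes w: "w \<notin> fn P \<union> hn h \<union> ffn (DiaIn a \<psi>)"
  shows "sat P h (DiaIn a \<psi>) \<longleftrightarrow>
    (\<exists>Q. transition P (In a w) Q \<and> sat Q (h @ [IName w]) (fren (instn w) \<psi>))"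
proof
  assume "sat P h (DiaIn a \<psi>)"
  then obtain z Q where z: "z \<notin> fn P \<union> hn h \<union> ffn (DiaIn a \<psi>)"
    and t: "transition P (In a z) Q" and s: "sat Q (h @ [IName z]) (fren (instn z) \<psi>)"
    unfolding sat.simps by blast
  have "transition P (In a w) (ren (swapn z w) Q)"
    using transition_ren[OF t bij_is_inj[OF bij_swapn[of z w]]] z w by (simp add: swapn_id)
  moreover have "sat (ren (swapn z w) Q) (h @ [IName w]) (fren (instn w) \<psi>)"
    using sat_ren[OF bij_swapn[of z w], of Q "h @ [IName z]" "fren (instn z) \<psi>"] s z w
    by (simp add: hren_append swapn_id fren_instn_swap) (simp add: hren_def)
  ultimately show "\<exists>Q. transition P (In a w) Q \<and> sat Q (h @ [IName w]) (fren (instn w) \<psi>)"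
    by blast
next
  assume "\<exists>Q. transition P (In a w) Q \<and> sat Q (h @ [IName w]) (fren (instn w) \<psi>)"
  then show "sat P h (DiaIn a \<psi>)" unfolding sat.simps using w by blast
qed

lemma sat_BoxBOut_fresh:
  assumes w: "w \<notin> fn P \<union> hn h \<union> ffn (BoxBOut a \<psi>)"
  shows "sat P h (BoxBOut a \<psi>) \<longleftrightarrow>
    (\<forall>\<sigma> Q. is_subst \<sigma> \<and> respects_hist \<sigma> h \<and> fresh_subst w \<sigma> \<and>
       transition (ren \<sigma> P) (BOut (\<sigma> a) w) Q \<longrightarrow>
       sat Q (hren \<sigma> h @ [OName w]) (fren \<sigma> (fren (instn w) \<psi>)))" (is "?L \<longleftrightarrow> ?R")
proof
  assume ?L
  then show ?R unfolding sat.simps using w by blast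
next
  assume R: ?R
  show ?L unfolding sat.simps
  proof (intro allI impI, elim conjE)
    fix \<sigma> z Q assume \<sigma>: "is_subst \<sigma>" "respects_hist \<sigma> h"
      and z: "z \<notin> fn P \<union> hn h \<union> ffn (BoxBOut a \<psi>)" and f: "fresh_subst z \<sigma>"
      and t: "transition (ren \<sigma> P) (BOut (\<sigma> a) z) Q"
    let ?p = "swapn z w"
    have pp: "?p \<circ> ?p = id" by (auto simp: swapn_def fun_eq_iff)
    then have pp': "?p (?p x) = x" for x by (metis comp_apply id_apply)
    have hp: "hren ?p h = h" and Pp: "ren ?p P = P" using z w by (simp_all add: swapn_id)
    from conj_subst[OF bij_swapn[of z w], of \<sigma> h] \<sigma> hp f obtain \<tau>
      where \<tau>: "is_subst \<tau>" "respects_hist \<tau> h" "\<sigma> \<circ> ?p = ?p \<circ> \<tau>" and fw: "fresh_subst w \<tau>"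
      by (metis swapn_simps(2))
    have "?p a = a" using z w by (intro swapn_simps(3)) auto
    then have a: "?p (\<sigma> a) = \<tau> a" using \<tau>(3) pp' by (metis comp_apply)
    have "ren ?p (ren \<sigma> P) = ren (?p \<circ> (\<sigma> \<circ> ?p)) P"
      by (subst Pp[symmetric]) (simp add: ren_ren)
    also have "\<dots> = ren \<tau> P" by (simp add: \<tau>(3) o_assoc pp)
    finally have "transition (ren \<tau> P) (BOut (\<tau> a) w) (ren ?p Q)"
      using transition_ren[OF t bij_is_inj[OF bij_swapn[of z w]]] a by simp
    with R \<tau> fw have "sat (ren ?p Q) (hren \<tau> h @ [OName w]) (fren \<tau> (fren (instn w) \<psi>))"
      by blast
    then have "sat (ren ?p (ren ?p Q)) (hren ?p (hren \<tau> h @ [OName w]))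
        (fren ?p (fren \<tau> (fren (instn w) \<psi>)))"
      by (simp only: sat_ren[OF bij_swapn])
    moreover have "hren ?p (hren \<tau> h @ [OName w]) = hren \<sigma> h @ [OName z]"
    proof -
      have "hren ?p (hren \<tau> h) = hren \<sigma> (hren ?p h)" by (simp only: hren_hren \<tau>(3))
      then show ?thesis by (simp add: hren_append hp) (simp add: hren_def)
    qed
    moreover have "fren ?p (fren \<tau> (fren (instn w) \<psi>)) = fren \<sigma> (fren (instn z) \<psi>)"
    proof -
      have "fren ?p (fren \<tau> (fren (instn w) \<psi>)) = fren \<sigma> (fren ?p (fren (instn w) \<psi>))"
        by (simp only: fren_fren o_assoc \<tau>(3))
      also have "fren ?p (fren (instn w) \<psi>) = fren (?p \<circ> ?p) (fren (instn z) \<psi>)"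
        using z w by (simp add: fren_instn_swap flip: fren_fren)
      finally show ?thesis by (simp add: pp fren_id)
    qed
    ultimately show "sat Q (hren \<sigma> h @ [OName z]) (fren \<sigma> (fren (instn z) \<psi>))"
      by (simp add: ren_ren pp ren_id)
  qed
qed

lemma sat_BoxIn_fresh:
  assumes w: "w \<notin> fn P \<union> hn h \<union> ffn (BoxIn a \<psi>)"
  shows "sat P h (BoxIn a \<psi>) \<longleftrightarrow>
    (\<forall>\<sigma> Q. is_subst \<sigma> \<and> respects_hist \<sigma> h \<and> fresh_subst w \<sigma> \<and>
       transition (ren \<sigma> P) (In (\<sigma> a) w) Q \<longrightarrow>
       sat Q (hren \<sigma> h @ [IName w]) (fren \<sigma> (fren (instn w) \<psi>)))" (is "?L \<longleftrightarrow> ?R")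
proof
  assume ?L
  then show ?R unfolding sat.simps using w by blast
next
  assume R: ?R
  show ?L unfolding sat.simps
  proof (intro allI impI, elim conjE)
    fix \<sigma> z Q assume \<sigma>: "is_subst \<sigma>" "respects_hist \<sigma> h"
      and z: "z \<notin> fn P \<union> hn h \<union> ffn (BoxIn a \<psi>)" and f: "fresh_subst z \<sigma>"
      and t: "transition (ren \<sigma> P) (In (\<sigma> a) z) Q"
    let ?p = "swapn z w"
    have pp: "?p \<circ> ?p = id" by (auto simp: swapn_def fun_eq_iff)
    then have pp': "?p (?p x) = x" for x by (metis comp_apply id_apply)
    have hp: "hren ?p h = h" and Pp: "ren ?p P = P" using z w by (simp_all add: swapn_id)
    from conj_subst[OF bij_swapn[of z w], of \<sigma> h] \<sigma> hp f obtain \<tau>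
      where \<tau>: "is_subst \<tau>" "respects_hist \<tau> h" "\<sigma> \<circ> ?p = ?p \<circ> \<tau>" and fw: "fresh_subst w \<tau>"
      by (metis swapn_simps(2))
    have "?p a = a" using z w by (intro swapn_simps(3)) auto
    then have a: "?p (\<sigma> a) = \<tau> a" using \<tau>(3) pp' by (metis comp_apply)
    have "ren ?p (ren \<sigma> P) = ren (?p \<circ> (\<sigma> \<circ> ?p)) P"
      by (subst Pp[symmetric]) (simp add: ren_ren)
    also have "\<dots> = ren \<tau> P" by (simp add: \<tau>(3) o_assoc pp)
    finally have "transition (ren \<tau> P) (In (\<tau> a) w) (ren ?p Q)"
      using transition_ren[OF t bij_is_inj[OF bij_swapn[of z w]]] a by simp
    with R \<tau> fw have "sat (ren ?p Q) (hren \<tau> h @ [IName w]) (fren \<tau> (fren (instn w) \<psi>))"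
      by blast
    then have "sat (ren ?p (ren ?p Q)) (hren ?p (hren \<tau> h @ [IName w]))
        (fren ?p (fren \<tau> (fren (instn w) \<psi>)))"
      by (simp only: sat_ren[OF bij_swapn])
    moreover have "hren ?p (hren \<tau> h @ [IName w]) = hren \<sigma> h @ [IName z]"
    proof -
      have "hren ?p (hren \<tau> h) = hren \<sigma> (hren ?p h)" by (simp only: hren_hren \<tau>(3))
      then show ?thesis by (simp add: hren_append hp) (simp add: hren_def)
    qed
    moreover have "fren ?p (fren \<tau> (fren (instn w) \<psi>)) = fren \<sigma> (fren (instn z) \<psi>)"
    proof -
      have "fren ?p (fren \<tau> (fren (instn w) \<psi>)) = fren \<sigma> (fren ?p (fren (instn w) \<psi>))"
        by (simp only: fren_fren o_assoc \<tau>(3))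
      also have "fren ?p (fren (instn w) \<psi>) = fren (?p \<circ> ?p) (fren (instn z) \<psi>)"
        using z w by (simp add: fren_instn_swap flip: fren_fren)
      finally show ?thesis by (simp add: pp fren_id)
    qed
    ultimately show "sat Q (hren \<sigma> h @ [IName z]) (fren \<sigma> (fren (instn z) \<psi>))"
      by (simp add: ren_ren pp ren_id)
  qed
qed

lemma sat_dia_BOut:
  assumes "z \<notin> fn P \<union> hn h" "z \<noteq> a"
  shows "sat P h (dia (BOut a z) \<phi>) \<longleftrightarrow>
    (\<exists>Q. transition P (BOut a z) Q \<and> sat Q (h @ [OName z]) \<phi>)"
  using sat_DiaBOut_fresh[of z P h a "fren (bindn z) \<phi>"] assms
  by (simp add: ffn_fren vimage_bindn fren_instn_bindn del: sat.simps)

lemma sat_box_BOut: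
  assumes "z \<notin> fn P \<union> hn h" "z \<noteq> a"
  shows "sat P h (box (BOut a z) \<phi>) \<longleftrightarrow>
    (\<forall>\<sigma> Q. is_subst \<sigma> \<and> respects_hist \<sigma> h \<and> fresh_subst z \<sigma> \<and>
       transition (ren \<sigma> P) (BOut (\<sigma> a) z) Q \<longrightarrow>
       sat Q (hren \<sigma> h @ [OName z]) (fren \<sigma> \<phi>))"
  using sat_BoxBOut_fresh[of z P h a "fren (bindn z) \<phi>"] assms
  by (simp add: ffn_fren vimage_bindn fren_instn_bindn del: sat.simps)

lemma sat_dia_In:
  assumes "z \<notin> fn P \<union> hn h" "z \<noteq> a"
  shows "sat P h (dia (In a z) \<phi>) \<longleftrightarrow>
    (\<exists>Q. transition P (In a z) Q \<and> sat Q (h @ [IName z]) \<phi>)"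
  using sat_DiaIn_fresh[of z P h a "fren (bindn z) \<phi>"] assms
  by (simp add: ffn_fren vimage_bindn fren_instn_bindn del: sat.simps)

lemma sat_box_In:
  assumes "z \<notin> fn P \<union> hn h" "z \<noteq> a"
  shows "sat P h (box (In a z) \<phi>) \<longleftrightarrow>
    (\<forall>\<sigma> Q. is_subst \<sigma> \<and> respects_hist \<sigma> h \<and> fresh_subst z \<sigma> \<and>
       transition (ren \<sigma> P) (In (\<sigma> a) z) Q \<longrightarrow>
       sat Q (hren \<sigma> h @ [IName z]) (fren \<sigma> \<phi>))"
  using sat_BoxIn_fresh[of z P h a "fren (bindn z) \<phi>"] assms
  by (simp add: ffn_fren vimage_bindn fren_instn_bindn del: sat.simps)

end

theory Submission
  imports Defs
begin

text \<open>
  The relation \<open>indist h\<close>, which holds of \<open>P\<close> and \<open>Q\<close> unless there are both a formula true of \<open>P\<close>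
  only and a formula true of \<open>Q\<close> only, is an open bisimulation. Keeping both formulae makes up for
  the missing negation.

  Suppose \<open>P\<close> moves to \<open>P'\<close> and every matching derivative \<open>Q\<^sub>i\<close> is told apart from \<open>P'\<close> by
  \<open>\<phi>\<^sub>i\<close> (true of \<open>P'\<close>) and \<open>\<psi>\<^sub>i\<close> (true of \<open>Q\<^sub>i\<close>). There are finitely many of them. A diamond over the
  conjunction of the \<open>\<phi>\<^sub>i\<close> holds of \<open>P\<close> only. A box over the disjunction of the \<open>\<psi>\<^sub>i\<close> need
  not hold of \<open>Q\<close>, since a substitution may enable new moves, but only one that identifies
  two names does; so adding all equations between distinct names as disjuncts makes the box true
  of \<open>Q\<close>, and it stays false for \<open>P\<close>. If \<open>\<phi>\<close> tells \<open>P\<sigma>\<close> from \<open>Q\<sigma>\<close>, then the implication from the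
  equations that \<open>\<sigma>\<close> validates to a \<open>\<sigma>\<close>-preimage of \<open>\<phi>\<close> tells \<open>P\<close> from \<open>Q\<close>, because satisfaction is
  monotone under respectful substitutions.
\<close>

section \<open>Transitions without named binders\<close>

text \<open>After a label with a bound name, index 0 of the derivative stands for that name, so
  transitions are preserved by arbitrary substitutions and there are finitely many of them.\<close>

datatype 'a lab = LTau | LOut 'a 'a | LBOut 'a | LIn 'a

fun bound :: "'a lab \<Rightarrow> bool" where
  "bound (LBOut x) = True"
| "bound (LIn x) = True"
| "bound l = False"

text \<open>Shifts replace the freshness side conditions. In \<open>Res\<close>, the premise label
  \<open>map_lab Suc l\<close> says that the restricted name, index 0, does not occur in it. If the
  label is bound, index 0 of the derivative is the label's name and index 1 the restricted one, so
  the two are swapped before \<open>Nu\<close> binds index 0. In \<open>Open\<close> index 0 already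
  is the extruded name.\<close>

inductive der :: "proc \<Rightarrow> name lab \<Rightarrow> proc \<Rightarrow> bool" where
  Tau: "der (PreTau P) LTau P"
| Out: "der (PreOut x y P) (LOut x y) P"
| BOut: "der (PreBOut x P) (LBOut x) P"
| In: "der (PreIn x P) (LIn x) P"
| Open: "der P (LOut (Suc x) 0) Q \<Longrightarrow> der (Nu P) (LBOut x) Q"
| Sum1: "der P l R \<Longrightarrow> der (Sum P Q) l R"
| Sum2: "der P l R \<Longrightarrow> der (Sum Q P) l R"
| Match: "der P l R \<Longrightarrow> der (Match x x P) l R"
| Res: "der P (map_lab Suc l) Q \<Longrightarrow>
    der (Nu P) l (Nu (if bound l then ren (swapn 0 (Suc 0)) Q else Q))"
| Par1: "der P l P' \<Longrightarrow> der (Par P R) l (Par P' (if bound l then ren Suc R else R))"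
| Par2: "der P l P' \<Longrightarrow> der (Par R P) l (Par (if bound l then ren Suc R else R) P')"
| Close1: "der P (LBOut x) P' \<Longrightarrow> der Q (LIn x) Q' \<Longrightarrow> der (Par P Q) LTau (Nu (Par P' Q'))"
| Close2: "der P (LBOut x) P' \<Longrightarrow> der Q (LIn x) Q' \<Longrightarrow> der (Par Q P) LTau (Nu (Par Q' P'))"
| Comm1: "der P (LOut x y) P' \<Longrightarrow> der Q (LIn x) Q' \<Longrightarrow>
    der (Par P Q) LTau (Par P' (ren (instn y) Q'))"
| Comm2: "der P (LOut x y) P' \<Longrightarrow> der Q (LIn x) Q' \<Longrightarrow>
    der (Par Q P) LTau (Par (ren (instn y) Q') P')"

lemma bound_map_lab [simp]: "bound (map_lab f l) = bound l"
  by (cases l) auto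

lemma lift_swapn: "swapn 0 (Suc 0) \<circ> lift (lift \<sigma>) = lift (lift \<sigma>) \<circ> swapn 0 (Suc 0)"
proof
  fix n show "(swapn 0 (Suc 0) \<circ> lift (lift \<sigma>)) n = (lift (lift \<sigma>) \<circ> swapn 0 (Suc 0)) n"
    by (cases n; cases "n - 1") (auto simp: swapn_def lift_def)
qed

lemma instn_simps [simp]: "instn z 0 = z" "instn z (Suc n) = n"
  by (simp_all add: instn_def)

lemma lift_Suc: "lift \<sigma> \<circ> Suc = Suc \<circ> \<sigma>"
  by (simp add: fun_eq_iff)

text \<open>No rule demands that two names differ or that a name be fresh, so even a substitution
  that identifies names preserves every rule.\<close>

lemma der_ren:
  assumes "der P l Q"
  shows "der (ren \<sigma> P) (map_lab \<sigma> l) (ren (if bound l then lift \<sigma> else \<sigma>) Q)"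
  using assms
proof (induction arbitrary: \<sigma> rule: der.induct)
  case (Open P x Q)
  from Open.IH[of "lift \<sigma>"] show ?case by (auto intro: der.Open)
next
  case (Res P l Q)
  have "der (ren (lift \<sigma>) P) (map_lab Suc (map_lab \<sigma> l))
      (ren (if bound l then lift (lift \<sigma>) else lift \<sigma>) Q)"
    using Res.IH[of "lift \<sigma>"] by (simp add: lab.map_comp lift_Suc split: if_splits)
  from der.Res[OF this] show ?case by (simp add: ren_ren lift_swapn split: if_splits)
next
  case (Par1 P l P' R)
  from der.Par1[OF Par1.IH[of \<sigma>], of "ren \<sigma> R"] show ?case
    by (simp add: ren_ren lift_Suc split: if_splits)
next
  case (Par2 P l P' R)
  from der.Par2[OF Par2.IH[of \<sigma>], of "ren \<sigma> R"] show ?case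
    by (simp add: ren_ren lift_Suc split: if_splits)
next
  case (Close1 P x P' Q Q')
  from Close1.IH[of \<sigma>] show ?case by (auto intro: der.Close1)
next
  case (Close2 P x P' Q Q')
  from Close2.IH[of \<sigma>] show ?case by (auto intro: der.Close2)
next
  case (Comm1 P x y P' Q Q')
  have "der (Par (ren \<sigma> P) (ren \<sigma> Q)) LTau
      (Par (ren \<sigma> P') (ren (instn (\<sigma> y)) (ren (lift \<sigma>) Q')))"
    using Comm1.IH[of \<sigma>] by (intro der.Comm1) auto
  then show ?case by (simp add: ren_ren instn_lift)
next
  case (Comm2 P x y P' Q Q')
  have "der (Par (ren \<sigma> Q) (ren \<sigma> P)) LTau
      (Par (ren (instn (\<sigma> y)) (ren (lift \<sigma>) Q')) (ren \<sigma> P'))"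
    using Comm2.IH[of \<sigma>] by (intro der.Comm2) auto
  then show ?case by (simp add: ren_ren instn_lift)
qed (auto intro: der.intros)

text \<open>Stripping both inner binders forgets the order of their indices.\<close>

lemma vimage_Suc_swapn: "Suc -` (Suc -` (swapn 0 (Suc 0) ` A)) = Suc -` (Suc -` A)"
proof -
  have "Suc (Suc n) \<in> swapn 0 (Suc 0) ` A \<longleftrightarrow> Suc (Suc n) \<in> A" for n
    by (auto simp: image_iff swapn_def)
  then show ?thesis by auto
qed

lemma der_fn:
  assumes "der P l Q"
  shows "set_lab l \<subseteq> fn P" "(if bound l then Suc -` fn Q else fn Q) \<subseteq> fn P"
  using assms
proof (induction rule: der.induct)
  case (Open P x Q)
  {
    case 1 show ?case using Open by auto
  next
    case 2 show ?case using Open by auto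
  }
next
  case (Res P l Q)
  {
    case 1 show ?case using Res by (auto simp: lab.set_map)
  next
    case 2 show ?case using Res by (auto simp: fn_ren vimage_Suc_swapn split: if_splits)
  }
next
  case (Close1 P x P' Q Q') { case 1 show ?case by simp next case 2 show ?case using Close1 by auto }
next
  case (Close2 P x P' Q Q') { case 1 show ?case by simp next case 2 show ?case using Close2 by auto }
next
  case (Comm1 P x y P' Q Q')
  {
    case 1 show ?case by simp
  next
    case 2 show ?case using Comm1 by (auto simp: fn_ren instn_def subset_iff split: nat.splits)
  }
next
  case (Comm2 P x y P' Q Q')
  {
    case 1 show ?case by simp
  next
    case 2 show ?case using Comm2 by (auto simp: fn_ren instn_def subset_iff split: nat.splits)
  }
qed (auto simp: fn_ren split: if_splits)

section \<open>Finite branching\<close>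

inductive_cases der_PNilE: "der PNil l Q"
inductive_cases der_NuE: "der (Nu P) l Q"
inductive_cases der_PreTauE: "der (PreTau P) l Q"
inductive_cases der_PreOutE: "der (PreOut x y P) l Q"
inductive_cases der_PreBOutE: "der (PreBOut x P) l Q"
inductive_cases der_PreInE: "der (PreIn x P) l Q"
inductive_cases der_MatchE: "der (Match x y P) l Q"
inductive_cases der_SumE: "der (Sum P R) l Q"
inductive_cases der_ParE: "der (Par P R) l Q"

text \<open>Each rule builds a derivative from derivatives of the components, so structural
  induction bounds the set by finite images. Bound labels carry no chosen name, hence there are no
  alpha-variants to count.\<close>

lemma finite_der: "finite {(l, Q). der P l Q}"
proof (induction P)
  case PNil
  have "{(l, Q). der PNil l Q} = {}" by (auto elim: der_PNilE)
  then show ?case by simp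
next
  case (Nu P)
  let ?D = "{(l, Q). der P l Q}"
  have "inj (map_lab Suc)" by (simp add: lab.inj_map)
  then have l: "inv (map_lab Suc) (map_lab Suc l) = l" for l :: "nat lab" by simp
  \<comment> \<open>The first image covers \<open>Res\<close>, the second \<open>Open\<close>, where
    \<open>x - 1\<close> undoes the shift. Values at other labels are harmless, since only an upper
    bound is claimed.\<close>
  have "{(l, Q). der (Nu P) l Q} \<subseteq>
      (\<lambda>(l, Q). (inv (map_lab Suc) l, Nu (if bound l then ren (swapn 0 (Suc 0)) Q else Q))) ` ?D \<union>
      (\<lambda>(l, Q). (case l of LOut x y \<Rightarrow> LBOut (x - 1), Q)) ` ?D"
    by (force elim!: der_NuE simp: l image_iff)
  then show ?case using Nu by (meson finite_UnI finite_imageI finite_subset)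
next
  case (Par P R)
  let ?D = "{(l, Q). der P l Q}" and ?E = "{(l, Q). der R l Q}"
  let ?N = "\<lambda>l. case l of LOut x y \<Rightarrow> y"
  have "{(l, Q). der (Par P R) l Q} \<subseteq>
      (\<lambda>(l, Q). (l, Par Q (if bound l then ren Suc R else R))) ` ?D \<union>
      (\<lambda>(l, Q). (l, Par (if bound l then ren Suc P else P) Q)) ` ?E \<union>
      (\<lambda>((l, Q), (l', Q')). (LTau, Nu (Par Q Q'))) ` (?D \<times> ?E) \<union>
      (\<lambda>((l, Q), (l', Q')). (LTau, Par Q (ren (instn (?N l)) Q'))) ` (?D \<times> ?E) \<union>
      (\<lambda>((l, Q), (l', Q')). (LTau, Par (ren (instn (?N l')) Q) Q')) ` (?D \<times> ?E)" (is "_ \<subseteq> ?S")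
  proof
    fix x assume "x \<in> {(l, Q). der (Par P R) l Q}"
    then obtain l Q where x: "x = (l, Q)" and d: "der (Par P R) l Q" by blast
    from d show "x \<in> ?S" unfolding x
      by (cases rule: der_ParE) (force simp: image_iff)+
  qed
  moreover have "finite ?S" using Par by (intro finite_UnI finite_imageI finite_cartesian_product)
  ultimately show ?case by (rule finite_subset)
next
  case (Sum P R)
  have "{(l, Q). der (Sum P R) l Q} \<subseteq> {(l, Q). der P l Q} \<union> {(l, Q). der R l Q}"
    by (auto elim: der_SumE)
  then show ?case using Sum by (meson finite_UnI finite_subset)
next
  case (Match x y P)
  have "{(l, Q). der (Match x y P) l Q} \<subseteq> {(l, Q). der P l Q}" by (auto elim: der_MatchE)
  then show ?case using Match by (meson finite_subset)
next
  case (PreTau P)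
  have "{(l, Q). der (PreTau P) l Q} \<subseteq> {(LTau, P)}" by (auto elim: der_PreTauE)
  then show ?case by (meson finite.intros finite_subset)
next
  case (PreOut x y P)
  have "{(l, Q). der (PreOut x y P) l Q} \<subseteq> {(LOut x y, P)}" by (auto elim: der_PreOutE)
  then show ?case by (meson finite.intros finite_subset)
next
  case (PreBOut x P)
  have "{(l, Q). der (PreBOut x P) l Q} \<subseteq> {(LBOut x, P)}" by (auto elim: der_PreBOutE)
  then show ?case by (meson finite.intros finite_subset)
next
  case (PreIn x P)
  have "{(l, Q). der (PreIn x P) l Q} \<subseteq> {(LIn x, P)}" by (auto elim: der_PreInE)
  then show ?case by (meson finite.intros finite_subset)
qed

section \<open>Correspondence between named and nameless transitions\<close>

fun lab_of :: "act \<Rightarrow> name lab" where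
  "lab_of Tau = LTau"
| "lab_of (Out x y) = LOut x y"
| "lab_of (BOut x z) = LBOut x"
| "lab_of (In x z) = LIn x"

text \<open>Translates a named derivative into its nameless form; \<open>open_act\<close> translates
  back.\<close>

fun close_act :: "act \<Rightarrow> proc \<Rightarrow> proc" where
  "close_act (BOut x z) P = ren (bindn z) P"
| "close_act (In x z) P = ren (bindn z) P"
| "close_act \<pi> P = P"

fun open_act :: "act \<Rightarrow> proc \<Rightarrow> proc" where
  "open_act (BOut x z) P = ren (instn z) P"
| "open_act (In x z) P = ren (instn z) P"
| "open_act \<pi> P = P"

lemma open_close_act [simp]: "open_act \<pi> (close_act \<pi> P) = P"
  by (cases \<pi>) (simp_all add: ren_ren instn_bindn id_upd ren_id)

lemma map_lab_bindn: "x \<notin> n_act \<pi> \<Longrightarrow> map_lab (bindn x) (lab_of \<pi>) = map_lab Suc (lab_of \<pi>)"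
  by (cases \<pi>) (auto simp: bindn_def)

lemma ren_bindn_fresh: "z \<notin> fn P \<Longrightarrow> ren (bindn z) P = ren Suc P"
  by (rule ren_cong) (auto simp: bindn_def)

text \<open>Binding \<open>z\<close> before \<open>x\<close> or after it yields the indices 0 and 1
  in opposite order; this is what the swap in rule \<open>Res\<close> corrects.\<close>

lemma bindn_swap:
  "x \<noteq> z \<Longrightarrow> swapn 0 (Suc 0) \<circ> (lift (bindn x) \<circ> bindn z) = lift (bindn z) \<circ> bindn x"
  by (auto simp: fun_eq_iff bindn_def)

lemma close_act_Par:
  "bn_act \<pi> \<inter> fn R = {} \<Longrightarrow>
     close_act \<pi> (Par P R) = Par (close_act \<pi> P) (if bound (lab_of \<pi>) then ren Suc R else R)"
  "bn_act \<pi> \<inter> fn R = {} \<Longrightarrow>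
     close_act \<pi> (Par R P) = Par (if bound (lab_of \<pi>) then ren Suc R else R) (close_act \<pi> P)"
  by (cases \<pi>; simp add: ren_bindn_fresh)+

lemma ren_instn_bindn: "ren (instn y) (ren (bindn z) P) = ren (id(z := y)) P"
  by (simp add: ren_ren instn_bindn)

lemma transition_imp_der: "transition P \<pi> Q \<Longrightarrow> der P (lab_of \<pi>) (close_act \<pi> Q)"
proof (induction rule: transition.induct)
  case (Pre \<pi> P)
  then show ?case by (cases \<pi>) (auto intro: der.intros)
next
  case (Open P x z Q)
  \<comment> \<open>As \<open>x \<noteq> z\<close>, binding \<open>z\<close> turns the label into
    \<open>LOut (Suc x) 0\<close>, the form that rule \<open>Open\<close> expects.\<close>
  from der_ren[OF Open.IH, of "bindn z"] Open.hyps(2) show ?case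
    by (auto simp: nu_def bindn_def intro: der.Open)
next
  case (Res P \<pi> Q x)
  \<comment> \<open>Since \<open>x\<close> does not occur in the action, binding it merely shifts
    the label.\<close>
  have "der (ren (bindn x) P) (map_lab Suc (lab_of \<pi>))
      (ren (if bound (lab_of \<pi>) then lift (bindn x) else bindn x) (close_act \<pi> Q))"
    using der_ren[OF Res.IH, of "bindn x"] by (simp only: map_lab_bindn[OF Res.hyps(2)])
  from der.Res[OF this] show ?case using Res.hyps(2)
    by (cases \<pi>) (auto simp: nu_def ren_ren bindn_swap)
next
  case (Par1 P \<pi> Q R)
  then show ?case by (simp only: close_act_Par der.Par1)
next
  case (Par2 P \<pi> Q R)
  then show ?case by (simp only: close_act_Par der.Par2)
next
  case (Comm1 P x y P' Q z Q')
  then show ?case using der.Comm1[of P x y P' Q "ren (bindn z) Q'"]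
    by (simp add: ren_instn_bindn)
next
  case (Comm2 P x y P' Q z Q')
  then show ?case using der.Comm2[of P x y P' Q "ren (bindn z) Q'"]
    by (simp add: ren_instn_bindn)
qed (auto simp: nu_def intro: der.intros)

lemma ex_fresh: "finite A \<Longrightarrow> \<exists>z::name. z \<notin> A"
  by (simp add: ex_new_if_finite)

lemma finite_n_act: "finite (n_act \<pi>)"
  by (cases \<pi>) auto

text \<open>Reconciles the derivative of the named rule \<open>Res\<close>, with \<open>w\<close> as
  restricted name, with that of the nameless rule. As \<open>w\<close> avoids the images of the free
  names under the binder and the names of the action, rebinding it captures nothing.\<close>

lemma open_act_Nu:
  assumes w: "w \<notin> \<sigma> ` (Suc -` fn P)" "w \<notin> n_act \<pi>" and d: "der P (map_lab Suc l) Q"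
    and l: "lab_of \<pi> = map_lab \<sigma> l"
  shows "nu w (open_act \<pi> (ren (if bound l then lift (instn w \<circ> lift \<sigma>) else instn w \<circ> lift \<sigma>) Q)) =
    open_act \<pi> (ren (if bound l then lift \<sigma> else \<sigma>)
      (Nu (if bound l then ren (swapn 0 (Suc 0)) Q else Q)))"
proof (cases "bound l")
  case True
  then obtain x z where \<pi>: "\<pi> = BOut x z \<or> \<pi> = In x z"
    using l by (cases \<pi>; cases l) auto
  then have z: "w \<noteq> z" using w by auto
  have "ren (bindn w \<circ> (instn z \<circ> lift (instn w \<circ> lift \<sigma>))) Q =
      ren (lift (instn z) \<circ> (lift (lift \<sigma>) \<circ> swapn 0 (Suc 0))) Q"
  proof (rule ren_cong, rule ballI)
    fix n assume n: "n \<in> fn Q"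
    show "(bindn w \<circ> (instn z \<circ> lift (instn w \<circ> lift \<sigma>))) n =
      (lift (instn z) \<circ> (lift (lift \<sigma>) \<circ> swapn 0 (Suc 0))) n"
    \<comment> \<open>Index 0 is the label's bound name, index 1 the restricted name; an index
      \<open>Suc (Suc k)\<close> comes from a free name \<open>k\<close> of \<open>Nu P\<close>, so
      \<open>w\<close> differs from its image.\<close>
    proof (cases n)
      case 0
      with z show ?thesis by (simp add: bindn_def instn_def)
    next
      case (Suc m)
      show ?thesis
      proof (cases m)
        case 0
        with Suc show ?thesis by (simp add: bindn_def instn_def)
      next
        case (Suc k)
        with n \<open>n = Suc m\<close> der_fn(2)[OF d] True w have "w \<noteq> \<sigma> k" by auto
        with Suc \<open>n = Suc m\<close> show ?thesis by (simp add: bindn_def instn_def)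
      qed
    qed
  qed
  with True \<pi> show ?thesis by (auto simp: nu_def ren_ren)
next
  case False
  have "ren (bindn w \<circ> (instn w \<circ> lift \<sigma>)) Q = ren (lift \<sigma>) Q"
  proof (rule ren_cong, rule ballI)
    fix n assume n: "n \<in> fn Q"
    show "(bindn w \<circ> (instn w \<circ> lift \<sigma>)) n = lift \<sigma> n"
      using n der_fn(2)[OF d] False w by (cases n) (auto simp: bindn_def instn_def)
  qed
  moreover have "open_act \<pi> = id" using False l by (cases \<pi>; cases l) auto
  ultimately show ?thesis using False by (simp add: nu_def ren_ren)
qed

lemma der_bound_fresh:
  assumes "der P l Q" "bound l" "z \<notin> fn (ren \<sigma> P)"
  shows "Suc z \<notin> fn (ren (lift \<sigma>) Q)"
proof -
  have "z \<notin> Suc -` (lift \<sigma> ` fn Q)"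
    unfolding vimage_lift using der_fn(2)[OF assms(1)] assms(2,3) by (auto simp: fn_ren)
  then show ?thesis by (simp add: fn_ren)
qed

text \<open>The substitution is built in to make the induction work: under \<open>Nu\<close>, index
  0 of the body must receive a name \<open>w\<close>, and
  \<open>instn w \<circ> lift \<sigma>\<close> does this as another instance of the induction
  hypothesis.\<close>

lemma der_imp_transition_ren:
  assumes "der P l Q" "lab_of \<pi> = map_lab \<sigma> l" "bn_act \<pi> \<inter> fn (ren \<sigma> P) = {}"
  shows "transition (ren \<sigma> P) \<pi> (open_act \<pi> (ren (if bound l then lift \<sigma> else \<sigma>) Q))"
  using assms
proof (induction arbitrary: \<sigma> \<pi> rule: der.induct)
  case (Tau P)
  then show ?case using transition.Pre[of Tau] by (cases \<pi>) auto
next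
  case (Out x y P)
  then show ?case using transition.Pre[of "Out (\<sigma> x) (\<sigma> y)"] by (cases \<pi>) auto
next
  case (BOut x P)
  then obtain z where \<pi>: "\<pi> = BOut (\<sigma> x) z" by (cases \<pi>) auto
  with BOut show ?case
    using transition.Pre[of \<pi> "ren (instn z) (ren (lift \<sigma>) P)"] by (simp add: ren_bindn_instn fn_ren)
next
  case (In x P)
  then obtain z where \<pi>: "\<pi> = In (\<sigma> x) z" by (cases \<pi>) auto
  with In show ?case
    using transition.Pre[of \<pi> "ren (instn z) (ren (lift \<sigma>) P)"] by (simp add: ren_bindn_instn fn_ren)
next
  case (Open P x Q)
  then obtain z where \<pi>: "\<pi> = BOut (\<sigma> x) z" by (cases \<pi>) auto
  have t: "transition (ren (instn z \<circ> lift \<sigma>) P) (Out (\<sigma> x) z) (ren (instn z \<circ> lift \<sigma>) Q)"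
    using Open.IH[of "Out (\<sigma> x) z" "instn z \<circ> lift \<sigma>"] by (simp add: comp_def)
  have z: "z \<notin> fn (Nu (ren (lift \<sigma>) P))" using Open.prems \<pi> by simp
  have "Suc x \<in> fn P" using der_fn(1)[OF Open.hyps] by simp
  then have "\<sigma> x \<in> fn (Nu (ren (lift \<sigma>) P))" by (auto simp: fn_ren vimage_lift)
  with z have "\<sigma> x \<noteq> z" by auto
  from transition.Open[OF t this] show ?case
    using Nu_named[OF z] by (simp add: \<pi> ren_ren)
next
  case (Res P l Q)
  \<comment> \<open>The restricted name \<open>w\<close> is picked apart from the action, as the
    side condition of the named rule \<open>Res\<close> requires.\<close>
  have "finite (fn (ren \<sigma> (Nu P)) \<union> n_act \<pi>)" by (intro finite_UnI finite_fn finite_n_act)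
  from ex_fresh[OF this] obtain w where w: "w \<notin> fn (Nu (ren (lift \<sigma>) P))" "w \<notin> n_act \<pi>" by auto
  let ?\<sigma> = "instn w \<circ> lift \<sigma>"
  have "?\<sigma> \<circ> Suc = \<sigma>" by (simp add: fun_eq_iff instn_def)
  then have l: "lab_of \<pi> = map_lab ?\<sigma> (map_lab Suc l)" using Res.prems(1) by (simp only: lab.map_comp)
  have "?\<sigma> n \<in> insert w (fn (ren \<sigma> (Nu P)))" if "n \<in> fn P" for n
    using that by (cases n) (auto simp: fn_ren vimage_lift)
  then have "fn (ren ?\<sigma> P) \<subseteq> insert w (fn (ren \<sigma> (Nu P)))" unfolding fn_ren by blast
  moreover have "bn_act \<pi> \<subseteq> n_act \<pi>" by (cases \<pi>) auto
  ultimately have "bn_act \<pi> \<inter> fn (ren ?\<sigma> P) = {}" using Res.prems(2) w(2) by blast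
  from transition.Res[OF Res.IH[OF l this] w(2)]
  have "transition (nu w (ren ?\<sigma> P)) \<pi>
      (nu w (open_act \<pi> (ren (if bound l then lift ?\<sigma> else ?\<sigma>) Q)))" by (simp only: bound_map_lab)
  moreover have "nu w (ren ?\<sigma> P) = ren \<sigma> (Nu P)" using Nu_named[OF w(1)] by (simp add: ren_ren)
  moreover have "w \<notin> \<sigma> ` (Suc -` fn P)" using w(1) by (simp add: fn_ren vimage_lift)
  ultimately show ?case using open_act_Nu[OF _ w(2) Res.hyps Res.prems(1)] by simp
next
  case (Sum1 P l R Q)
  from Sum1.prems show ?case unfolding ren.simps by (intro transition.Sum1 Sum1.IH) auto
next
  case (Sum2 P l R Q)
  from Sum2.prems show ?case unfolding ren.simps by (intro transition.Sum2 Sum2.IH) auto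
next
  case (Match P l R x)
  from Match.prems show ?case unfolding ren.simps by (intro transition.Match Match.IH) auto
next
  case (Par1 P l P' R)
  have "transition (Par (ren \<sigma> P) (ren \<sigma> R)) \<pi>
      (Par (open_act \<pi> (ren (if bound l then lift \<sigma> else \<sigma>) P')) (ren \<sigma> R))"
    using Par1.prems by (intro transition.Par1 Par1.IH) auto
  moreover have "instn z \<circ> (Suc \<circ> \<sigma>) = \<sigma>" for z by (simp add: fun_eq_iff instn_def)
  ultimately show ?case using Par1.prems(1) by (cases \<pi>; cases l) (simp_all add: ren_ren lift_Suc)
next
  case (Par2 P l P' R)
  have "transition (Par (ren \<sigma> R) (ren \<sigma> P)) \<pi>
      (Par (ren \<sigma> R) (open_act \<pi> (ren (if bound l then lift \<sigma> else \<sigma>) P')))"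
    using Par2.prems by (intro transition.Par2 Par2.IH) auto
  moreover have "instn z \<circ> (Suc \<circ> \<sigma>) = \<sigma>" for z by (simp add: fun_eq_iff instn_def)
  ultimately show ?case using Par2.prems(1) by (cases \<pi>; cases l) (simp_all add: ren_ren lift_Suc)
next
  case (Close1 P x P' Q Q')
  have \<pi>: "\<pi> = Tau" using Close1.prems by (cases \<pi>) auto
  \<comment> \<open>Both partners can use the same bound name only if it is fresh for both.\<close>
  have "finite (fn (ren \<sigma> (Par P Q)))" by (rule finite_fn)
  from ex_fresh[OF this] obtain z where z: "z \<notin> fn (ren \<sigma> P)" "z \<notin> fn (ren \<sigma> Q)" by auto
  have "transition (Par (ren \<sigma> P) (ren \<sigma> Q)) Tau
      (nu z (Par (ren (instn z) (ren (lift \<sigma>) P')) (ren (instn z) (ren (lift \<sigma>) Q'))))"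
    using Close1.IH(1)[of "BOut (\<sigma> x) z" \<sigma>] Close1.IH(2)[of "In (\<sigma> x) z" \<sigma>] z
    by (intro transition.Close1) auto
  moreover have "Suc z \<notin> fn (ren (lift \<sigma>) P')" "Suc z \<notin> fn (ren (lift \<sigma>) Q')"
    using z Close1.hyps by (simp_all add: der_bound_fresh)
  ultimately show ?case by (simp add: \<pi> nu_def ren_bindn_instn)
next
  case (Close2 P x P' Q Q')
  have \<pi>: "\<pi> = Tau" using Close2.prems by (cases \<pi>) auto
  have "finite (fn (ren \<sigma> (Par P Q)))" by (rule finite_fn)
  from ex_fresh[OF this] obtain z where z: "z \<notin> fn (ren \<sigma> P)" "z \<notin> fn (ren \<sigma> Q)" by auto
  have "transition (Par (ren \<sigma> Q) (ren \<sigma> P)) Tau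
      (nu z (Par (ren (instn z) (ren (lift \<sigma>) Q')) (ren (instn z) (ren (lift \<sigma>) P'))))"
    using Close2.IH(1)[of "BOut (\<sigma> x) z" \<sigma>] Close2.IH(2)[of "In (\<sigma> x) z" \<sigma>] z
    by (intro transition.Close2) auto
  moreover have "Suc z \<notin> fn (ren (lift \<sigma>) P')" "Suc z \<notin> fn (ren (lift \<sigma>) Q')"
    using z Close2.hyps by (simp_all add: der_bound_fresh)
  ultimately show ?case by (simp add: \<pi> nu_def ren_bindn_instn)
next
  case (Comm1 P x y P' Q Q')
  have \<pi>: "\<pi> = Tau" using Comm1.prems by (cases \<pi>) auto
  have "finite (fn (ren \<sigma> Q))" by (rule finite_fn)
  from ex_fresh[OF this] obtain z where z: "z \<notin> fn (ren \<sigma> Q)" by auto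
  \<comment> \<open>Any fresh \<open>z\<close> serves as the input's bound name: instantiating index
    0 with \<open>z\<close> and then replacing \<open>z\<close> by \<open>\<sigma> y\<close> amounts
    to instantiating with \<open>\<sigma> y\<close>.\<close>
  have "transition (Par (ren \<sigma> P) (ren \<sigma> Q)) Tau
      (Par (ren \<sigma> P') (ren (id(z := \<sigma> y)) (ren (instn z) (ren (lift \<sigma>) Q'))))"
    using Comm1.IH(1)[of "Out (\<sigma> x) (\<sigma> y)" \<sigma>] Comm1.IH(2)[of "In (\<sigma> x) z" \<sigma>] z
    by (intro transition.Comm1) auto
  moreover have "Suc z \<notin> fn (ren (lift \<sigma>) Q')"
    using z Comm1.hyps(2) by (simp add: der_bound_fresh)
  ultimately show ?case
    by (simp add: \<pi> ren_bindn_instn ren_ren[of "instn y"] flip: ren_instn_bindn)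
       (simp add: ren_ren instn_lift)
next
  case (Comm2 P x y P' Q Q')
  have \<pi>: "\<pi> = Tau" using Comm2.prems by (cases \<pi>) auto
  have "finite (fn (ren \<sigma> Q))" by (rule finite_fn)
  from ex_fresh[OF this] obtain z where z: "z \<notin> fn (ren \<sigma> Q)" by auto
  have "transition (Par (ren \<sigma> Q) (ren \<sigma> P)) Tau
      (Par (ren (id(z := \<sigma> y)) (ren (instn z) (ren (lift \<sigma>) Q'))) (ren \<sigma> P'))"
    using Comm2.IH(1)[of "Out (\<sigma> x) (\<sigma> y)" \<sigma>] Comm2.IH(2)[of "In (\<sigma> x) z" \<sigma>] z
    by (intro transition.Comm2) auto
  moreover have "Suc z \<notin> fn (ren (lift \<sigma>) Q')"
    using z Comm2.hyps(2) by (simp add: der_bound_fresh)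
  ultimately show ?case
    by (simp add: \<pi> ren_bindn_instn ren_ren[of "instn y"] flip: ren_instn_bindn)
       (simp add: ren_ren instn_lift)
qed

section \<open>Consequences for named transitions\<close>

text \<open>The detour through \<open>der\<close> removes the named binders with which
  \<open>\<sigma>\<close> could clash; freshness of the bound name allows the way back with that
  same name.\<close>

lemma transition_subst:
  assumes t: "transition P \<pi> Q" and z: "\<forall>z\<in>bn_act \<pi>. fresh_subst z \<sigma> \<and> z \<notin> fn P"
  shows "transition (ren \<sigma> P) (act_ren \<sigma> \<pi>) (ren \<sigma> Q)"
proof -
  have "lab_of (act_ren \<sigma> \<pi>) = map_lab \<sigma> (lab_of \<pi>)" by (cases \<pi>) auto
  moreover have "bn_act (act_ren \<sigma> \<pi>) \<inter> fn (ren \<sigma> P) = {}"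
    using z by (cases \<pi>) (auto simp: fn_ren fresh_subst_def, metis+)
  moreover have "open_act (act_ren \<sigma> \<pi>) (ren (if bound (lab_of \<pi>) then lift \<sigma> else \<sigma>) (close_act \<pi> Q))
      = ren \<sigma> Q"
    using z by (cases \<pi>) (auto simp: fresh_subst_def ren_ren lift_bindn instn_bindn id_upd
        simp flip: o_assoc intro!: arg_cong[where f = "\<lambda>\<sigma>. ren \<sigma> Q"],
        auto simp: fun_eq_iff instn_def bindn_def)
  ultimately show ?thesis using der_imp_transition_ren[OF transition_imp_der[OF t]] by metis
qed

text \<open>Once the action, and with it the bound name, is fixed, a derivative is recovered from
  its nameless form.\<close>

lemma finite_transition: "finite {Q. transition P \<pi> Q}"
proof -
  have "{Q. transition P \<pi> Q} \<subseteq> (\<lambda>(l, Q). open_act \<pi> Q) ` {(l, Q). der P l Q}"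
    using transition_imp_der by (force simp: image_iff)
  then show ?thesis using finite_der by (meson finite_imageI finite_subset)
qed

lemma transition_fn:
  assumes "transition P \<pi> Q"
  shows "set_lab (lab_of \<pi>) \<subseteq> fn P" "fn Q \<subseteq> fn P \<union> bn_act \<pi>"
  using der_fn[OF transition_imp_der[OF assms]]
  by (simp, cases \<pi>) (auto simp: fn_ren vimage_bindn)

section \<open>Respectful substitutions\<close>

lemma hn_append [simp]: "hn (h @ k) = hn h \<union> hn k"
  by (simp add: hn_def image_Un)

lemma hn_simps [simp]: "hn [] = {}" "hn (a # h) = insert (the_name a) (hn h)"
  by (simp_all add: hn_def)

lemma hren_simps [simp]: "hren \<sigma> [] = []" "hren \<sigma> (a # h) = hname_ren \<sigma> a # hren \<sigma> h"
  by (simp_all add: hren_def)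

text \<open>A recursion from the right end of the history, in place of the quantification over
  splittings; \<open>hist_induct\<close> is the matching induction.\<close>

lemma respects_hist_simps [simp]:
  "respects_hist \<sigma> []"
  "respects_hist \<sigma> (h @ [IName z]) \<longleftrightarrow> respects_hist \<sigma> h"
  "respects_hist \<sigma> (h @ [OName z]) \<longleftrightarrow>
     respects_hist \<sigma> h \<and> \<sigma> z = z \<and> (\<forall>y\<in>hn h. \<sigma> y \<noteq> z)"
proof -
  have eq: "h @ [a] = h1 @ [OName x] @ h2 \<longleftrightarrow>
      (\<exists>h3. h2 = h3 @ [a] \<and> h = h1 @ [OName x] @ h3) \<or> (h2 = [] \<and> h1 = h \<and> a = OName x)"
    for a h1 x h2 by (cases h2 rule: rev_cases) auto
  show "respects_hist \<sigma> []" by (simp add: respects_hist_def)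
  show "respects_hist \<sigma> (h @ [IName z]) \<longleftrightarrow> respects_hist \<sigma> h"
    unfolding respects_hist_def eq by blast
  show "respects_hist \<sigma> (h @ [OName z]) \<longleftrightarrow>
     respects_hist \<sigma> h \<and> \<sigma> z = z \<and> (\<forall>y\<in>hn h. \<sigma> y \<noteq> z)"
    unfolding respects_hist_def eq hname.inject by blast
qed

lemma respects_hist_cong:
  "\<forall>x\<in>hn h. \<sigma> x = \<tau> x \<Longrightarrow> respects_hist \<sigma> h \<longleftrightarrow> respects_hist \<tau> h"
  unfolding respects_hist_def by auto

lemma respects_hist_map_IName [simp]: "respects_hist \<sigma> (map IName xs)"
  by (induction xs rule: rev_induct) auto

lemma hist_induct [case_names Nil OName IName]:
  assumes "Q []" "\<And>h z. Q h \<Longrightarrow> Q (h @ [OName z])" "\<And>h z. Q h \<Longrightarrow> Q (h @ [IName z])"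
  shows "Q h"
proof (induction h rule: rev_induct)
  case (snoc a h)
  then show ?case using assms(2,3) by (cases a) auto
qed (rule assms(1))

text \<open>At an output \<open>z\<close>, \<open>\<sigma>\<close> fixes \<open>z\<close> and the
  earlier names of \<open>hren \<sigma> h\<close> are the images of those of \<open>h\<close>, so
  the conditions on \<open>\<tau>\<close> and on \<open>\<tau> \<circ> \<sigma>\<close>
  coincide.\<close>

lemma respects_hist_comp:
  "respects_hist \<sigma> h \<Longrightarrow> respects_hist (\<tau> \<circ> \<sigma>) h \<longleftrightarrow> respects_hist \<tau> (hren \<sigma> h)"
  by (induction h rule: hist_induct) (auto simp: hren_append hn_hren)

text \<open>\<open>id\<close> respects a history exactly if each output name is new where it occurs.
  This serves as the well-formedness condition on histories.\<close>

lemma respects_hist_id_hren: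
  "respects_hist \<sigma> h \<Longrightarrow> respects_hist id (hren \<sigma> h)"
  using respects_hist_comp[of \<sigma> h id] by simp

lemma is_subst_comp: "is_subst \<sigma> \<Longrightarrow> is_subst \<tau> \<Longrightarrow> is_subst (\<tau> \<circ> \<sigma>)"
proof -
  have "{x. (\<tau> \<circ> \<sigma>) x \<noteq> x} \<subseteq> {x. \<sigma> x \<noteq> x} \<union> {x. \<tau> x \<noteq> x}" by auto
  then show "is_subst \<sigma> \<Longrightarrow> is_subst \<tau> \<Longrightarrow> is_subst (\<tau> \<circ> \<sigma>)"
    unfolding is_subst_def by (meson finite_UnI finite_subset)
qed

lemma is_subst_id: "is_subst id"
  by (simp add: is_subst_def)

lemma fresh_subst_comp: "fresh_subst z \<sigma> \<Longrightarrow> fresh_subst z \<tau> \<Longrightarrow> fresh_subst z (\<tau> \<circ> \<sigma>)"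
  by (simp add: fresh_subst_def)

lemma ex_fresh_subst:
  assumes "is_subst \<sigma>" "finite A"
  obtains z where "fresh_subst z \<sigma>" "z \<notin> A" "z \<notin> \<sigma> ` A"
proof -
  let ?M = "{x. \<sigma> x \<noteq> x}"
  have "finite (?M \<union> \<sigma> ` ?M \<union> A \<union> \<sigma> ` A)" using assms by (simp add: is_subst_def)
  from ex_fresh[OF this] obtain z where z: "z \<notin> ?M \<union> \<sigma> ` ?M \<union> A \<union> \<sigma> ` A" by blast
  then have "fresh_subst z \<sigma>" unfolding fresh_subst_def by auto
  with z that show ?thesis by blast
qed

section \<open>Monotonicity of satisfaction\<close>

lemma fren_instn_lift: "fren \<sigma> (fren (instn z) \<phi>) = fren (instn (\<sigma> z)) (fren (lift \<sigma>) \<phi>)"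
  by (simp add: fren_fren instn_lift)

text \<open>Diamonds are preserved because transitions survive substitution. Boxes and implications
  already quantify over all respectful substitutions, among them every
  \<open>\<tau> \<circ> \<sigma>\<close>.\<close>

lemma sat_mono:
  assumes "sat P h \<phi>" "is_subst \<sigma>" "respects_hist \<sigma> h"
  shows "sat (ren \<sigma> P) (hren \<sigma> h) (fren \<sigma> \<phi>)"
  using assms
proof (induction "size \<phi>" arbitrary: \<phi> P h rule: less_induct)
  case less
  note s = less.prems(1) and \<sigma> = less.prems(2,3)
  have comp: "is_subst (\<tau> \<circ> \<sigma>) \<and> respects_hist (\<tau> \<circ> \<sigma>) h"
    if "is_subst \<tau>" "respects_hist \<tau> (hren \<sigma> h)" for \<tau>
    using that \<sigma> by (simp add: is_subst_comp respects_hist_comp)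
  have fin: "finite (fn P \<union> hn h \<union> ffn \<phi>)" by (simp add: finite_fn finite_hn finite_ffn)
  \<comment> \<open>One \<open>z\<close>, untouched by \<open>\<sigma>\<close> and fresh both before
    and after it, serves as bound name in all modalities.\<close>
  from ex_fresh_subst[OF \<sigma>(1) fin] obtain z
    where z: "fresh_subst z \<sigma>" "z \<notin> fn P \<union> hn h \<union> ffn \<phi>" "z \<notin> \<sigma> ` (fn P \<union> hn h \<union> ffn \<phi>)" .
  have \<sigma>z: "\<sigma> z = z" using z(1) by (simp add: fresh_subst_def)
  have z': "z \<notin> fn (ren \<sigma> P) \<union> hn (hren \<sigma> h) \<union> ffn (fren \<sigma> \<phi>)"
    using z(3) by (simp add: fn_ren hn_hren ffn_fren image_Un)
  show ?case
  proof (cases \<phi>)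
    case (Conj \<phi>1 \<phi>2)
    then show ?thesis using s less.hyps[of \<phi>1] less.hyps[of \<phi>2] \<sigma> by auto
  next
    case (Disj \<phi>1 \<phi>2)
    then show ?thesis using s less.hyps[of \<phi>1] less.hyps[of \<phi>2] \<sigma> by auto
  next
    case (Imp \<phi>1 \<phi>2)
    then show ?thesis using s comp by (auto simp: ren_ren hren_hren fren_fren)
  next
    case (DiaTau \<psi>)
    with s obtain Q where Q: "transition P Tau Q" "sat Q h \<psi>" by auto
    have "sat (ren \<sigma> Q) (hren \<sigma> h) (fren \<sigma> \<psi>)"
      using less.hyps[OF _ Q(2) \<sigma>] by (simp add: DiaTau)
    then show ?thesis using transition_subst[OF Q(1), of \<sigma>] by (auto simp: DiaTau)
  next
    case (DiaOut a b \<psi>)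
    with s obtain Q where Q: "transition P (Out a b) Q" "sat Q h \<psi>" by auto
    have "sat (ren \<sigma> Q) (hren \<sigma> h) (fren \<sigma> \<psi>)"
      using less.hyps[OF _ Q(2) \<sigma>] by (simp add: DiaOut)
    then show ?thesis using transition_subst[OF Q(1), of \<sigma>] by (auto simp: DiaOut)
  next
    case (DiaBOut a \<psi>)
    from s z(2) obtain Q where Q: "transition P (BOut a z) Q"
      "sat Q (h @ [OName z]) (fren (instn z) \<psi>)"
      unfolding DiaBOut by (subst (asm) sat_DiaBOut_fresh) auto
    have "respects_hist \<sigma> (h @ [OName z])" using \<sigma>(2) \<sigma>z z(3) by force
    from less.hyps[OF _ Q(2) \<sigma>(1) this]
    have "sat (ren \<sigma> Q) (hren \<sigma> h @ [OName z]) (fren (instn z) (fren (lift \<sigma>) \<psi>))"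
      by (simp add: DiaBOut fren_instn_lift \<sigma>z hren_append)
    moreover have "transition (ren \<sigma> P) (BOut (\<sigma> a) z) (ren \<sigma> Q)"
      using transition_subst[OF Q(1), of \<sigma>] z \<sigma>z by simp
    ultimately show ?thesis using z' unfolding DiaBOut fren.simps sat.simps by blast
  next
    case (DiaIn a \<psi>)
    from s z(2) obtain Q where Q: "transition P (In a z) Q"
      "sat Q (h @ [IName z]) (fren (instn z) \<psi>)"
      unfolding DiaIn by (subst (asm) sat_DiaIn_fresh) auto
    have "respects_hist \<sigma> (h @ [IName z])" using \<sigma>(2) by simp
    from less.hyps[OF _ Q(2) \<sigma>(1) this]
    have "sat (ren \<sigma> Q) (hren \<sigma> h @ [IName z]) (fren (instn z) (fren (lift \<sigma>) \<psi>))"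
      by (simp add: DiaIn fren_instn_lift \<sigma>z hren_append)
    moreover have "transition (ren \<sigma> P) (In (\<sigma> a) z) (ren \<sigma> Q)"
      using transition_subst[OF Q(1), of \<sigma>] z \<sigma>z by simp
    ultimately show ?thesis using z' unfolding DiaIn fren.simps sat.simps by blast
  next
    case (BoxTau \<psi>)
    then show ?thesis using s comp by (auto simp: ren_ren hren_hren fren_fren)
  next
    case (BoxOut a b \<psi>)
    then show ?thesis using s comp by (auto simp: ren_ren hren_hren fren_fren)
  next
    case (BoxBOut a \<psi>)
    from s z(2) have s': "\<forall>\<sigma> Q. is_subst \<sigma> \<and> respects_hist \<sigma> h \<and> fresh_subst z \<sigma> \<and>
       transition (ren \<sigma> P) (BOut (\<sigma> a) z) Q \<longrightarrow>
       sat Q (hren \<sigma> h @ [OName z]) (fren \<sigma> (fren (instn z) \<psi>))"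
      unfolding BoxBOut by (subst (asm) sat_BoxBOut_fresh) auto
    show ?thesis unfolding BoxBOut fren.simps
    proof (subst sat_BoxBOut_fresh[of z], use z' BoxBOut in simp, intro allI impI, elim conjE)
      fix \<tau> Q assume \<tau>: "is_subst \<tau>" "respects_hist \<tau> (hren \<sigma> h)" "fresh_subst z \<tau>"
        and "transition (ren \<tau> (ren \<sigma> P)) (BOut (\<tau> (\<sigma> a)) z) Q"
      with s'[rule_format, of "\<tau> \<circ> \<sigma>" Q] comp[OF \<tau>(1,2)] fresh_subst_comp[OF z(1) \<tau>(3)]
      have "sat Q (hren (\<tau> \<circ> \<sigma>) h @ [OName z]) (fren (\<tau> \<circ> \<sigma>) (fren (instn z) \<psi>))"
        by (simp add: ren_ren)
      then show "sat Q (hren \<tau> (hren \<sigma> h) @ [OName z])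
          (fren \<tau> (fren (instn z) (fren (lift \<sigma>) \<psi>)))"
        using fren_instn_lift[of \<sigma> z \<psi>] by (simp add: \<sigma>z hren_hren flip: fren_fren)
    qed
  next
    case (BoxIn a \<psi>)
    from s z(2) have s': "\<forall>\<sigma> Q. is_subst \<sigma> \<and> respects_hist \<sigma> h \<and> fresh_subst z \<sigma> \<and>
       transition (ren \<sigma> P) (In (\<sigma> a) z) Q \<longrightarrow>
       sat Q (hren \<sigma> h @ [IName z]) (fren \<sigma> (fren (instn z) \<psi>))"
      unfolding BoxIn by (subst (asm) sat_BoxIn_fresh) auto
    show ?thesis unfolding BoxIn fren.simps
    proof (subst sat_BoxIn_fresh[of z], use z' BoxIn in simp, intro allI impI, elim conjE)
      fix \<tau> Q assume \<tau>: "is_subst \<tau>" "respects_hist \<tau> (hren \<sigma> h)" "fresh_subst z \<tau>"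
        and "transition (ren \<tau> (ren \<sigma> P)) (In (\<tau> (\<sigma> a)) z) Q"
      with s'[rule_format, of "\<tau> \<circ> \<sigma>" Q] comp[OF \<tau>(1,2)] fresh_subst_comp[OF z(1) \<tau>(3)]
      have "sat Q (hren (\<tau> \<circ> \<sigma>) h @ [IName z]) (fren (\<tau> \<circ> \<sigma>) (fren (instn z) \<psi>))"
        by (simp add: ren_ren)
      then show "sat Q (hren \<tau> (hren \<sigma> h) @ [IName z])
          (fren \<tau> (fren (instn z) (fren (lift \<sigma>) \<psi>)))"
        using fren_instn_lift[of \<sigma> z \<psi>] by (simp add: \<sigma>z hren_hren flip: fren_fren)
    qed
  qed (use s in auto)
qed

section \<open>Histories that start with inputs\<close>

lemma hn_map_IName [simp]: "hn (map IName xs) = set xs"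
  by (simp add: hn_def image_image)

text \<open>Inputs matter only as names with which later outputs must not be identified.\<close>

lemma respects_hist_inputs:
  "set xs = set ys \<Longrightarrow>
     respects_hist \<sigma> (map IName xs @ k) \<longleftrightarrow> respects_hist \<sigma> (map IName ys @ k)"
proof (induction k rule: hist_induct)
  case (OName h z)
  with OName show ?case by (simp flip: append_assoc)
qed (simp_all flip: append_assoc)

lemma hren_map_IName [simp]: "hren \<sigma> (map IName xs) = map IName (map \<sigma> xs)"
  by (simp add: hren_def)

text \<open>A history enters satisfaction only through its names and the substitutions that respect
  it. The prefixes stay arbitrary in the induction because boxes and implications apply
  substitutions to them.\<close>

lemma sat_inputs:
  assumes "set xs = set ys" "sat P (map IName xs @ k) \<phi>"
  shows "sat P (map IName ys @ k) \<phi>"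
  using assms
proof (induction "size \<phi>" arbitrary: \<phi> P k xs ys rule: less_induct)
  case less
  note r = respects_hist_inputs[OF less.prems(1)]
  have img: "set (map \<sigma> xs) = set (map \<sigma> ys)" for \<sigma> :: "name \<Rightarrow> name"
    using less.prems(1) by simp
  have hn: "hn (map IName xs @ k) = hn (map IName ys @ k)"
    using less.prems(1) by simp
  have IH: "sat Q (map IName xs @ k) \<psi> \<Longrightarrow> sat Q (map IName ys @ k) \<psi>"
    if "size \<psi> < size \<phi>" for Q k \<psi>
    by (rule less.hyps[OF that less.prems(1)])
  have IH1: "sat Q (hren \<sigma> (map IName xs @ k) @ k') \<psi> \<Longrightarrow> sat Q (hren \<sigma> (map IName ys @ k) @ k') \<psi>"
    if "size \<psi> < size \<phi>" for Q k k' \<psi> \<sigma>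
    using less.hyps[OF that img[of \<sigma>], where k = "hren \<sigma> k @ k'"] by (simp add: hren_append)
  \<comment> \<open>The converse direction is for the premise of an implication.\<close>
  have IH2: "sat Q (hren \<sigma> (map IName ys @ k) @ k') \<psi> \<Longrightarrow> sat Q (hren \<sigma> (map IName xs @ k) @ k') \<psi>"
    if "size \<psi> < size \<phi>" for Q k k' \<psi> \<sigma>
    using less.hyps[OF that img[of \<sigma>, symmetric], where k = "hren \<sigma> k @ k'"] by (simp add: hren_append)
  note s = less.prems(2)
  show ?case
  proof (cases \<phi>)
    case (Imp \<phi>1 \<phi>2)
    then show ?thesis using s IH1[of "fren _ \<phi>2" _ _ _ "[]"] IH2[of "fren _ \<phi>1" _ _ _ "[]"] by (auto simp: r)
  next
    case (DiaBOut a \<psi>)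
    have "sat Q ((map IName xs @ k) @ [OName z]) (fren (instn z) \<psi>) \<Longrightarrow>
        sat Q ((map IName ys @ k) @ [OName z]) (fren (instn z) \<psi>)" for Q z
      unfolding append_assoc by (rule IH) (simp_all add: DiaBOut)
    with s show ?thesis unfolding DiaBOut sat.simps hn by blast
  next
    case (DiaIn a \<psi>)
    have "sat Q ((map IName xs @ k) @ [IName z]) (fren (instn z) \<psi>) \<Longrightarrow>
        sat Q ((map IName ys @ k) @ [IName z]) (fren (instn z) \<psi>)" for Q z
      unfolding append_assoc by (rule IH) (simp_all add: DiaIn)
    with s show ?thesis unfolding DiaIn sat.simps hn by blast
  next
    case (BoxTau \<psi>)
    then show ?thesis using s IH1[of "fren _ \<psi>" _ _ _ "[]"] by (auto simp: r)
  next
    case (BoxOut a b \<psi>)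
    then show ?thesis using s IH1[of "fren _ \<psi>" _ _ _ "[]"] by (auto simp: r)
  next
    case (BoxBOut a \<psi>)
    have "sat Q (hren \<sigma> (map IName xs @ k) @ [OName z]) (fren \<sigma> (fren (instn z) \<psi>)) \<Longrightarrow>
        sat Q (hren \<sigma> (map IName ys @ k) @ [OName z]) (fren \<sigma> (fren (instn z) \<psi>))" for Q z \<sigma>
      by (rule IH1) (simp_all add: BoxBOut)
    with s show ?thesis unfolding BoxBOut sat.simps hn r by blast
  next
    case (BoxIn a \<psi>)
    have "sat Q (hren \<sigma> (map IName xs @ k) @ [IName z]) (fren \<sigma> (fren (instn z) \<psi>)) \<Longrightarrow>
        sat Q (hren \<sigma> (map IName ys @ k) @ [IName z]) (fren \<sigma> (fren (instn z) \<psi>))" for Q z \<sigma>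
      by (rule IH1) (simp_all add: BoxIn)
    with s show ?thesis unfolding BoxIn sat.simps hn r by blast
  qed (use s IH in auto)
qed

section \<open>Open bisimilarity\<close>

definition conjs :: "form list \<Rightarrow> form" where
  "conjs \<phi>s = foldr Conj \<phi>s TT"

definition disjs :: "form list \<Rightarrow> form" where
  "disjs \<phi>s = foldr Disj \<phi>s FF"

lemma sat_conjs: "sat P h (conjs \<phi>s) \<longleftrightarrow> (\<forall>\<phi>\<in>set \<phi>s. sat P h \<phi>)"
  by (induction \<phi>s) (auto simp: conjs_def)

lemma sat_disjs: "sat P h (disjs \<phi>s) \<longleftrightarrow> (\<exists>\<phi>\<in>set \<phi>s. sat P h \<phi>)"
  by (induction \<phi>s) (auto simp: disjs_def)

lemma fren_conjs: "fren \<sigma> (conjs \<phi>s) = conjs (map (fren \<sigma>) \<phi>s)"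
  by (induction \<phi>s) (auto simp: conjs_def)

lemma fren_disjs: "fren \<sigma> (disjs \<phi>s) = disjs (map (fren \<sigma>) \<phi>s)"
  by (induction \<phi>s) (auto simp: disjs_def)

lemma ffn_conjs: "ffn (conjs \<phi>s) = (\<Union>\<phi>\<in>set \<phi>s. ffn \<phi>)"
  by (induction \<phi>s) (auto simp: conjs_def)

lemma ffn_disjs: "ffn (disjs \<phi>s) = (\<Union>\<phi>\<in>set \<phi>s. ffn \<phi>)"
  by (induction \<phi>s) (auto simp: disjs_def)

lemma ex_eqs:
  assumes "finite A" "\<And>x y. R x y \<Longrightarrow> x \<in> A \<and> y \<in> A"
  obtains \<epsilon>s where "set \<epsilon>s = {Eq x y | x y. R x y}"
proof -
  have "{Eq x y | x y. R x y} \<subseteq> case_prod Eq ` (A \<times> A)" using assms(2) by force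
  then have "finite {Eq x y | x y. R x y}"
    using assms(1) by (meson finite_SigmaI finite_imageI finite_subset)
  from finite_list[OF this] that show ?thesis by blast
qed

section \<open>Distinguishing formulae and substitution\<close>

text \<open>Deliberately one-sided, as a formula cannot simply be negated. Confined to names of the
  history, \<open>\<phi>\<close> is affected by a substitution only through its values
  there.\<close>

definition distinguishes :: "hist \<Rightarrow> proc \<Rightarrow> proc \<Rightarrow> bool" where
  "distinguishes h P Q \<longleftrightarrow> (\<exists>\<phi>. ffn \<phi> \<subseteq> hn h \<and> sat P h \<phi> \<and> \<not> sat Q h \<phi>)"

text \<open>A respectful \<open>\<theta>\<close> that validates the equations of
  \<open>\<sigma>\<close> factors on the history as \<open>\<rho> \<circ> \<sigma>\<close>, so
  monotonicity along \<open>\<rho>\<close> carries \<open>\<phi>\<close> from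
  \<open>ren \<sigma> P\<close> to \<open>ren \<theta> P\<close>. For \<open>Q\<close> the
  implication fails at \<open>\<sigma>\<close> itself.\<close>

lemma distinguishes_ren:
  assumes P: "fn P \<subseteq> hn h" and \<sigma>: "is_subst \<sigma>" "respects_hist \<sigma> h"
    and d: "distinguishes (hren \<sigma> h) (ren \<sigma> P) (ren \<sigma> Q)"
  shows "distinguishes h P Q"
proof -
  from d obtain \<phi> where \<phi>: "ffn \<phi> \<subseteq> \<sigma> ` hn h" "sat (ren \<sigma> P) (hren \<sigma> h) \<phi>"
    "\<not> sat (ren \<sigma> Q) (hren \<sigma> h) \<phi>" unfolding distinguishes_def hn_hren by blast
  \<comment> \<open>A section of \<open>\<sigma>\<close> over the image of the history, used to pull
    \<open>\<phi>\<close> back.\<close>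
  define s where "s = inv_into (hn h) \<sigma>"
  have s: "s y \<in> hn h" "\<sigma> (s y) = y" if "y \<in> \<sigma> ` hn h" for y
    using that unfolding s_def by (simp_all add: inv_into_into f_inv_into_f)
  obtain \<epsilon>s where \<epsilon>s: "set \<epsilon>s = {Eq x y | x y. x \<in> hn h \<and> y \<in> hn h \<and> \<sigma> x = \<sigma> y}"
    by (rule ex_eqs[OF finite_hn[of h], of "\<lambda>x y. x \<in> hn h \<and> y \<in> hn h \<and> \<sigma> x = \<sigma> y"]) auto
  let ?\<psi> = "Imp (conjs \<epsilon>s) (fren s \<phi>)"
  have "ffn ?\<psi> \<subseteq> hn h" using s(1) \<phi>(1) by (auto simp: ffn_conjs \<epsilon>s ffn_fren)
  moreover have "sat P h ?\<psi>"
    unfolding sat.simps(5)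
  proof (intro allI impI, elim conjE)
    fix \<theta> assume \<theta>: "is_subst \<theta>" "respects_hist \<theta> h"
      and "sat (ren \<theta> P) (hren \<theta> h) (fren \<theta> (conjs \<epsilon>s))"
    then have eq: "\<theta> x = \<theta> y" if "x \<in> hn h" "y \<in> hn h" "\<sigma> x = \<sigma> y" for x y
      using that by (force simp: fren_conjs sat_conjs \<epsilon>s)
    \<comment> \<open>By \<open>eq\<close> the chosen preimage does not matter; being the identity
      off the finite image gives \<open>\<rho>\<close> finite support.\<close>
    define \<rho> where "\<rho> y = (if y \<in> \<sigma> ` hn h then \<theta> (s y) else y)" for y
    have \<rho>: "(\<rho> \<circ> \<sigma>) x = \<theta> x" if "x \<in> hn h" for x
      using that s[of "\<sigma> x"] by (simp add: \<rho>_def eq[of "s (\<sigma> x)" x])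
    have "is_subst \<rho>" unfolding is_subst_def
      by (rule finite_subset[of _ "\<sigma> ` hn h"]) (auto simp: \<rho>_def finite_hn)
    moreover have "respects_hist \<rho> (hren \<sigma> h)"
      using \<theta>(2) \<rho> respects_hist_cong[of h "\<rho> \<circ> \<sigma>" \<theta>] respects_hist_comp[OF \<sigma>(2)] by blast
    ultimately have "sat (ren \<rho> (ren \<sigma> P)) (hren \<rho> (hren \<sigma> h)) (fren \<rho> \<phi>)"
      by (rule sat_mono[OF \<phi>(2)])
    moreover have "ren \<rho> (ren \<sigma> P) = ren \<theta> P"
      unfolding ren_ren using P \<rho> by (blast intro: ren_cong)
    moreover have "hren \<rho> (hren \<sigma> h) = hren \<theta> h"
      unfolding hren_hren using \<rho> by (blast intro: hren_cong)
    moreover have "fren \<rho> \<phi> = fren \<theta> (fren s \<phi>)"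
      unfolding fren_fren using \<phi>(1) by (intro fren_cong) (auto simp: \<rho>_def)
    ultimately show "sat (ren \<theta> P) (hren \<theta> h) (fren \<theta> (fren s \<phi>))" by simp
  qed
  moreover have "\<not> sat Q h ?\<psi>"
  proof -
    have "fren \<sigma> (fren s \<phi>) = fren id \<phi>"
      unfolding fren_fren using \<phi>(1) s(2) by (intro fren_cong) auto
    moreover have "sat (ren \<sigma> Q) (hren \<sigma> h) (fren \<sigma> (conjs \<epsilon>s))"
      by (auto simp: fren_conjs sat_conjs \<epsilon>s)
    ultimately show ?thesis unfolding sat.simps(5) using \<sigma> \<phi>(3) by (auto simp: fren_id)
  qed
  ultimately show ?thesis unfolding distinguishes_def by blast
qed

section \<open>Histories and modalities uniformly in the action\<close>

fun hist_ext :: "hist \<Rightarrow> act \<Rightarrow> hist" where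
  "hist_ext h (BOut a z) = h @ [OName z]"
| "hist_ext h (In a z) = h @ [IName z]"
| "hist_ext h \<pi> = h"

lemma hn_hist_ext: "hn (hist_ext h \<pi>) = hn h \<union> bn_act \<pi>"
  by (cases \<pi>) auto

lemma respects_hist_ext:
  assumes "respects_hist \<sigma> h" "bn_act \<pi> \<inter> hn h = {}" "\<forall>z\<in>bn_act \<pi>. fresh_subst z \<sigma>"
  shows "respects_hist \<sigma> (hist_ext h \<pi>)"
  using assms by (cases \<pi>) (auto simp: fresh_subst_def)

lemma hren_hist_ext:
  "\<forall>z\<in>bn_act \<pi>. fresh_subst z \<sigma> \<Longrightarrow> hren \<sigma> (hist_ext h \<pi>) = hist_ext (hren \<sigma> h) \<pi>"
  by (cases \<pi>) (auto simp: fresh_subst_def hren_append)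

lemma ffn_dia_box:
  "ffn (dia \<pi> \<phi>) = set_lab (lab_of \<pi>) \<union> (ffn \<phi> - bn_act \<pi>)"
  "ffn (box \<pi> \<phi>) = set_lab (lab_of \<pi>) \<union> (ffn \<phi> - bn_act \<pi>)"
  by (cases \<pi>; auto simp: ffn_fren vimage_bindn)+

lemma sat_dia:
  assumes "bn_act \<pi> \<inter> (fn P \<union> hn h \<union> set_lab (lab_of \<pi>)) = {}"
  shows "sat P h (dia \<pi> \<phi>) \<longleftrightarrow> (\<exists>Q. transition P \<pi> Q \<and> sat Q (hist_ext h \<pi>) \<phi>)"
  using assms
proof (cases \<pi>)
  case (BOut a z)
  with assms show ?thesis using sat_dia_BOut[of z P h a \<phi>] by simp
next
  case (In a z)
  with assms show ?thesis using sat_dia_In[of z P h a \<phi>] by simp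
qed simp_all

lemma sat_box:
  assumes "bn_act \<pi> \<inter> (fn P \<union> hn h \<union> set_lab (lab_of \<pi>)) = {}"
  shows "sat P h (box \<pi> \<phi>) \<longleftrightarrow>
    (\<forall>\<sigma> Q. is_subst \<sigma> \<and> respects_hist \<sigma> h \<and> (\<forall>z\<in>bn_act \<pi>. fresh_subst z \<sigma>) \<and>
       transition (ren \<sigma> P) (act_ren \<sigma> \<pi>) Q \<longrightarrow> sat Q (hist_ext (hren \<sigma> h) \<pi>) (fren \<sigma> \<phi>))"
  using assms
proof (cases \<pi>)
  case (BOut a z)
  have "act_ren \<sigma> \<pi> = BOut (\<sigma> a) z" if "fresh_subst z \<sigma>" for \<sigma>
    using that by (simp add: BOut fresh_subst_def)
  with BOut assms show ?thesis using sat_box_BOut[of z P h a \<phi>] by (simp del: act_ren.simps) metis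
next
  case (In a z)
  have "act_ren \<sigma> \<pi> = In (\<sigma> a) z" if "fresh_subst z \<sigma>" for \<sigma>
    using that by (simp add: In fresh_subst_def)
  with In assms show ?thesis using sat_box_In[of z P h a \<phi>] by (simp del: act_ren.simps) metis
qed simp_all

section \<open>Distinguishing formulae from the derivatives\<close>

text \<open>Each of the finitely many matching derivatives of \<open>Q\<close> fails its own
  conjunct, while \<open>P'\<close> satisfies them all; with no such derivative the conjunction is
  \<open>TT\<close>.\<close>

lemma distinguishes_dia:
  assumes t: "transition P \<pi> P'" and P: "fn P \<subseteq> hn h"
    and b: "bn_act \<pi> \<inter> (fn P \<union> fn Q \<union> hn h) = {}"
    and d: "\<And>Q'. transition Q \<pi> Q' \<Longrightarrow> distinguishes (hist_ext h \<pi>) P' Q'"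
  shows "distinguishes h P Q"
proof -
  from d obtain f where f: "\<And>Q'. transition Q \<pi> Q' \<Longrightarrow> ffn (f Q') \<subseteq> hn (hist_ext h \<pi>) \<and>
      sat P' (hist_ext h \<pi>) (f Q') \<and> \<not> sat Q' (hist_ext h \<pi>) (f Q')"
    unfolding distinguishes_def by metis
  from finite_list[OF finite_imageI[OF finite_transition]]
  obtain \<phi>s where \<phi>s: "set \<phi>s = f ` {Q'. transition Q \<pi> Q'}" ..
  have l: "set_lab (lab_of \<pi>) \<subseteq> hn h" using transition_fn(1)[OF t] P by blast
  let ?\<phi> = "dia \<pi> (conjs \<phi>s)"
  have "ffn ?\<phi> \<subseteq> hn h" using f l by (auto simp: ffn_dia_box ffn_conjs \<phi>s hn_hist_ext)
  moreover have "sat P h ?\<phi>"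
    using t f b l by (subst sat_dia) (auto simp: sat_conjs \<phi>s)
  moreover have "\<not> sat Q h ?\<phi>"
    using f b l by (subst sat_dia) (auto simp: sat_conjs \<phi>s)
  ultimately show ?thesis unfolding distinguishes_def by blast
qed

text \<open>A substitution that identifies no two names of the history has a left inverse there, hence
  enables no new transitions.\<close>

lemma transition_ren_inj:
  assumes t: "transition (ren \<sigma> Q) (act_ren \<sigma> \<pi>) Q''" and Q: "fn Q \<subseteq> A" "set_lab (lab_of \<pi>) \<subseteq> A"
    and inj: "inj_on \<sigma> A" and b: "\<forall>z\<in>bn_act \<pi>. fresh_subst z \<sigma> \<and> z \<notin> A"
  obtains Q' where "transition Q \<pi> Q'" "Q'' = ren \<sigma> Q'"
proof -
  \<comment> \<open>Inverts \<open>\<sigma>\<close> on the image of \<open>A\<close> and fixes the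
    bound names. All other names go to one name that is not bound, so that none is mapped onto a
    bound name and these stay fresh for \<open>\<rho>\<close>.\<close>
  define \<rho> where "\<rho> y = (if y \<in> \<sigma> ` A then inv_into A \<sigma> y else if y \<in> bn_act \<pi> then y else
      SOME x. x \<notin> bn_act \<pi>)" for y
  have "finite (bn_act \<pi>)" by (cases \<pi>) auto
  from ex_fresh[OF this] have some: "(SOME x. x \<notin> bn_act \<pi>) \<notin> bn_act \<pi>" by (rule someI_ex)
  have \<rho>\<sigma>: "\<rho> (\<sigma> x) = x" if "x \<in> A" for x using that inj by (simp add: \<rho>_def)
  have b': "z \<notin> \<sigma> ` A" "\<sigma> z = z" "z \<notin> fn (ren \<sigma> Q)" if "z \<in> bn_act \<pi>" for z
  proof -
    have z: "\<sigma> x = z \<longleftrightarrow> x = z" for x using b that by (simp add: fresh_subst_def)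
    then show "\<sigma> z = z" by simp
    show "z \<notin> \<sigma> ` A" using z b that by (metis imageE)
    then show "z \<notin> fn (ren \<sigma> Q)" using Q(1) unfolding fn_ren by blast
  qed
  have \<rho>z: "fresh_subst z \<rho>" if "z \<in> bn_act \<pi>" for z
    unfolding fresh_subst_def
  proof
    fix x show "\<rho> x = z \<longleftrightarrow> x = z"
      using b b' some that inv_into_into[of x \<sigma> A] by (auto simp: \<rho>_def)
  qed
  have bn: "bn_act (act_ren \<sigma> \<pi>) = bn_act \<pi>" using b'(2) by (simp add: bn_act_ren)
  have "transition (ren \<rho> (ren \<sigma> Q)) (act_ren \<rho> (act_ren \<sigma> \<pi>)) (ren \<rho> Q'')"
    using \<rho>z b'(3) by (intro transition_subst[OF t]) (simp add: bn)
  moreover have "ren \<rho> (ren \<sigma> Q) = ren id Q"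
    unfolding ren_ren using Q(1) \<rho>\<sigma> by (intro ren_cong) auto
  moreover have "act_ren \<rho> (act_ren \<sigma> \<pi>) = \<pi>"
    using Q(2) \<rho>\<sigma> \<rho>z b' by (cases \<pi>) (auto simp: fresh_subst_def)
  ultimately have "transition Q \<pi> (ren \<rho> Q'')" by (simp add: ren_id)
  \<comment> \<open>A derivative has only names from the image of \<open>A\<close> and bound ones,
    and on both \<open>\<sigma>\<close> undoes \<open>\<rho>\<close>.\<close>
  moreover have "\<sigma> (\<rho> y) = y" if "y \<in> fn Q''" for y
  proof -
    have "y \<in> \<sigma> ` A \<or> y \<in> bn_act \<pi>"
      using transition_fn(2)[OF t] that Q(1) unfolding bn fn_ren by blast
    then show ?thesis using \<rho>\<sigma> \<rho>z b'(2) unfolding fresh_subst_def by (metis imageE)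
  qed
  then have "ren \<sigma> (ren \<rho> Q'') = ren id Q''" unfolding ren_ren by (intro ren_cong) auto
  ultimately show ?thesis using that by (metis ren_id)
qed

text \<open>If \<open>\<sigma>\<close> is injective on the history, a move of
  \<open>ren \<sigma> Q\<close> is the image of a move of \<open>Q\<close>, whose formula is carried
  over by monotonicity. Otherwise \<open>\<sigma>\<close> validates one of the added
  equations.\<close>

lemma distinguishes_box:
  assumes t: "transition P \<pi> P'" and P: "fn P \<subseteq> hn h" "fn Q \<subseteq> hn h" and h: "respects_hist id h"
    and b: "bn_act \<pi> \<inter> hn h = {}"
    and d: "\<And>Q'. transition Q \<pi> Q' \<Longrightarrow> distinguishes (hist_ext h \<pi>) Q' P'"
  shows "distinguishes h Q P"
proof -
  from d obtain f where f: "\<And>Q'. transition Q \<pi> Q' \<Longrightarrow> ffn (f Q') \<subseteq> hn (hist_ext h \<pi>) \<and>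
      sat Q' (hist_ext h \<pi>) (f Q') \<and> \<not> sat P' (hist_ext h \<pi>) (f Q')"
    unfolding distinguishes_def by metis
  from finite_list[OF finite_imageI[OF finite_transition]]
  obtain \<phi>s where \<phi>s: "set \<phi>s = f ` {Q'. transition Q \<pi> Q'}" ..
  obtain \<epsilon>s where \<epsilon>s: "set \<epsilon>s = {Eq x y | x y. x \<in> hn h \<and> y \<in> hn h \<and> x \<noteq> y}"
    by (rule ex_eqs[OF finite_hn[of h], of "\<lambda>x y. x \<in> hn h \<and> y \<in> hn h \<and> x \<noteq> y"]) auto
  have l: "set_lab (lab_of \<pi>) \<subseteq> hn h" using transition_fn(1)[OF t] P by blast
  let ?\<phi> = "box \<pi> (disjs (\<phi>s @ \<epsilon>s))"
  have "ffn ?\<phi> \<subseteq> hn h" using f l by (auto simp: ffn_dia_box ffn_disjs \<phi>s \<epsilon>s hn_hist_ext)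
  moreover have "\<not> sat P h ?\<phi>"
  proof -
    \<comment> \<open>The box is refuted for \<open>P\<close> at the identity substitution, which is
      respectful by well-formedness of \<open>h\<close>.\<close>
    have "\<forall>z. fresh_subst z id" by (simp add: fresh_subst_def)
    moreover have "act_ren id \<pi> = \<pi>" by (cases \<pi>) auto
    moreover have "\<not> sat P' (hist_ext h \<pi>) (disjs (\<phi>s @ \<epsilon>s))"
      using f by (auto simp: sat_disjs \<phi>s \<epsilon>s)
    ultimately show ?thesis using t b l P h is_subst_id
      by (subst sat_box) (auto simp: hren_id fren_id ren_id intro!: exI[of _ id] exI[of _ P'])
  qed
  moreover have "sat Q h ?\<phi>"
  proof (subst sat_box, use b l P in blast, intro allI impI, elim conjE)
    fix \<sigma> Q'' assume \<sigma>: "is_subst \<sigma>" "respects_hist \<sigma> h" "\<forall>z\<in>bn_act \<pi>. fresh_subst z \<sigma>"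
      and t': "transition (ren \<sigma> Q) (act_ren \<sigma> \<pi>) Q''"
    show "sat Q'' (hist_ext (hren \<sigma> h) \<pi>) (fren \<sigma> (disjs (\<phi>s @ \<epsilon>s)))"
    proof (cases "inj_on \<sigma> (hn h)")
      case True
      obtain Q' where Q': "transition Q \<pi> Q'" "Q'' = ren \<sigma> Q'"
        using \<sigma>(3) b by (rule_tac transition_ren_inj[OF t' P(2) l True]) auto
      have "sat (ren \<sigma> Q') (hren \<sigma> (hist_ext h \<pi>)) (fren \<sigma> (f Q'))"
        using f[OF Q'(1)] \<sigma> b by (intro sat_mono respects_hist_ext) auto
      then show ?thesis using Q' hren_hist_ext[OF \<sigma>(3)]
        by (auto simp: fren_disjs sat_disjs \<phi>s)
    next
      case False
      then obtain x y where "x \<in> hn h" "y \<in> hn h" "x \<noteq> y" "\<sigma> x = \<sigma> y"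
        unfolding inj_on_def by blast
      then have "Eq x y \<in> set \<epsilon>s" "sat Q'' (hist_ext (hren \<sigma> h) \<pi>) (fren \<sigma> (Eq x y))"
        by (auto simp: \<epsilon>s)
      then show ?thesis unfolding fren_disjs sat_disjs by force
    qed
  qed
  ultimately show ?thesis unfolding distinguishes_def by blast
qed

section \<open>The bisimulation\<close>

text \<open>The first two conjuncts are invariants: output names are new where they occur, and the
  history covers all free names.\<close>

definition indist :: "hist \<Rightarrow> proc \<Rightarrow> proc \<Rightarrow> bool" where
  "indist h P Q \<longleftrightarrow> respects_hist id h \<and> fn P \<union> fn Q \<subseteq> hn h \<and>
     \<not> (distinguishes h P Q \<and> distinguishes h Q P)"

text \<open>If \<open>P'\<close> and every matching derivative could be told apart both ways, the
  diamond would tell \<open>P\<close> from \<open>Q\<close> and the box \<open>Q\<close> from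
  \<open>P\<close>.\<close>

lemma indist_transition:
  assumes i: "indist h P Q" and t: "transition P \<pi> P'" and b: "bn_act \<pi> \<inter> hn h = {}"
  shows "\<exists>Q'. transition Q \<pi> Q' \<and> indist (hist_ext h \<pi>) P' Q'"
proof -
  have P: "fn P \<subseteq> hn h" "fn Q \<subseteq> hn h" and h: "respects_hist id h"
    using i by (auto simp: indist_def)
  have "\<exists>Q'. transition Q \<pi> Q' \<and>
      \<not> (distinguishes (hist_ext h \<pi>) P' Q' \<and> distinguishes (hist_ext h \<pi>) Q' P')"
  proof (rule ccontr)
    assume "\<not> ?thesis"
    moreover have "bn_act \<pi> \<inter> (fn P \<union> fn Q \<union> hn h) = {}" using P b by blast
    ultimately have "distinguishes h P Q" "distinguishes h Q P"
      using distinguishes_dia[OF t P(1)] distinguishes_box[OF t P h b] by blast+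
    with i show False by (simp add: indist_def)
  qed
  then obtain Q' where Q': "transition Q \<pi> Q'"
    "\<not> (distinguishes (hist_ext h \<pi>) P' Q' \<and> distinguishes (hist_ext h \<pi>) Q' P')" by blast
  have "respects_hist id (hist_ext h \<pi>)"
    using h b by (rule respects_hist_ext) (simp add: fresh_subst_def)
  moreover have "fn P' \<union> fn Q' \<subseteq> hn (hist_ext h \<pi>)"
    using transition_fn(2)[OF t] transition_fn(2)[OF Q'(1)] P by (auto simp: hn_hist_ext)
  ultimately show ?thesis using Q' unfolding indist_def by blast
qed

lemma open_bisimulation_indist: "open_bisimulation indist"
  unfolding open_bisimulation_def
proof (intro conjI allI impI; (elim conjE)?)
  fix h P Q assume i: "indist h P Q"
  then show "indist h Q P" by (auto simp: indist_def)
  {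
    fix \<sigma> assume \<sigma>: "is_subst \<sigma>" "respects_hist \<sigma> h"
    show "indist (hren \<sigma> h) (ren \<sigma> P) (ren \<sigma> Q)"
      using i distinguishes_ren[OF _ \<sigma>] respects_hist_id_hren[OF \<sigma>(2)]
      by (auto simp: indist_def fn_ren hn_hren)
  next
    fix \<alpha> P' assume "\<alpha> = Tau \<or> (\<exists>a b. \<alpha> = Out a b)" and t: "transition P \<alpha> P'"
    then show "\<exists>Q'. transition Q \<alpha> Q' \<and> indist h P' Q'"
      using indist_transition[OF i t] by auto
  next
    fix a x P' assume x: "x \<notin> fn P \<union> fn Q \<union> hn h"
    {
      assume t: "transition P (BOut a x) P'"
      show "\<exists>Q'. transition Q (BOut a x) Q' \<and> indist (h @ [OName x]) P' Q'"
        using x indist_transition[OF i t] by simp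
    next
      assume t: "transition P (In a x) P'"
      show "\<exists>Q'. transition Q (In a x) Q' \<and> indist (h @ [IName x]) P' Q'"
        using x indist_transition[OF i t] by simp
    }
  }
qed

section \<open>Independence of the initial history, and conclusion\<close>

lemma sat_inputs_change:
  assumes s: "sat P (map IName ys) \<phi>" and sub: "ffn \<phi> \<subseteq> set xs" "fn P \<subseteq> set xs" "set xs \<subseteq> set ys"
    and ne: "xs \<noteq> []"
  shows "sat P (map IName xs) \<phi>"
proof -
  let ?\<sigma> = "\<lambda>x. if x \<in> set ys - set xs then hd xs else x"
  have "is_subst ?\<sigma>" unfolding is_subst_def by (rule finite_subset[of _ "set ys"]) auto
  from sat_mono[OF s this] have "sat (ren ?\<sigma> P) (map IName (map ?\<sigma> ys)) (fren ?\<sigma> \<phi>)" by simp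
  moreover have "ren ?\<sigma> P = ren id P" "fren ?\<sigma> \<phi> = fren id \<phi>"
    using sub by (auto intro!: ren_cong fren_cong)
  moreover have "set (map ?\<sigma> ys) = set xs" using sub(3) ne by (auto simp: image_iff)
  ultimately show ?thesis using sat_inputs[of "map ?\<sigma> ys" xs P "[]" \<phi>] by (simp add: ren_id fren_id)
qed

theorem theorem2:
  fixes P Q :: proc
  assumes "\<And>\<phi> :: form. P \<Turnstile> \<phi> \<longleftrightarrow> Q \<Turnstile> \<phi>"
  shows "P \<sim> Q"
proof -
  \<comment> \<open>The name 0 is added only to keep \<open>xs\<close> non-empty.\<close>
  have "finite (insert 0 (fn P \<union> fn Q))" by (simp add: finite_fn)
  then obtain xs where xs: "set xs = insert 0 (fn P \<union> fn Q)" using finite_list by blast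
  then have ne: "xs \<noteq> []" by auto
  have "\<not> distinguishes (map IName xs) P Q"
  proof
    assume "distinguishes (map IName xs) P Q"
    then obtain \<phi> where \<phi>: "ffn \<phi> \<subseteq> set xs" "sat P (map IName xs) \<phi>" "\<not> sat Q (map IName xs) \<phi>"
      by (auto simp: distinguishes_def)
    \<comment> \<open>The trivial equations force every history witnessing \<open>Q \<Turnstile> \<psi>\<close> to contain \<open>xs\<close>.\<close>
    let ?\<psi> = "Conj \<phi> (conjs (map (\<lambda>x. Eq x x) xs))"
    have "ffn ?\<psi> = set xs" using \<phi>(1) by (auto simp: ffn_conjs)
    moreover from this have "P \<Turnstile> ?\<psi>"
      unfolding satisfies_def using \<phi>(2) xs by (intro exI[of _ xs]) (auto simp: sat_conjs)
    with assms have "Q \<Turnstile> ?\<psi>" by blast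
    ultimately obtain ys where "set xs \<subseteq> set ys" "sat Q (map IName ys) \<phi>"
      unfolding satisfies_def by auto
    with \<phi>(1,3) xs ne show False using sat_inputs_change[of Q ys \<phi> xs] by auto
  qed
  \<comment> \<open>One direction suffices, as \<open>indist\<close> only excludes
    distinguishability in both.\<close>
  then have "indist (map IName xs) P Q" using xs by (auto simp: indist_def)
  then show ?thesis unfolding open_bisimilar_def using open_bisimulation_indist xs
    by (intro exI[of _ indist] exI[of _ xs]) auto
qed

end
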